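(* Let $$p = \frac{2(2^{1/3}+2^{2/3}+3^{1/3})(2^{1/3}-1)^{1/3}}{(9-2\cdot 3^{4/3})^{1/3}},$$ $a = 4\cdot 2^{1/3}3^{2/3}(1+2^{1/3}) + 2\cdot 3^{1/3}(2^{1/3}+2^{2/3})^2 + 6(1+2^{1/3}+2^{2/3})$, $b = 4\big(1 + 3^{1/3}(3^{1/3}+1) - 2\cdot 2^{1/3}(3^{1/3}+2^{1/3}-1)\big)$, $c = 4\big(1 - 2^{1/3}(3^{1/3}-1)(3^{1/3}+2^{1/3}-1)\big)$, $d = 4\big((2-2^{1/3})(1+2^{1/3}) - 3^{1/3}(2^{1/3}-1)(1+2^{1/3}+3^{1/3})\big)$, and $$\alpha = \tfrac19\big(a - b\cos\tfrac{\pi}{9} - c\cos\tfrac{2\pi}{9}\big),\quad \beta = \tfrac19\big(a + d\cos\tfrac{\pi}{9} - b\cos\tfrac{2\pi}{9}\big),\quad \gamma = \tfrac19\big(a - c\cos\tfrac{\pi}{9} + d\cos\tfrac{2\pi}{9}\big).$$ Set $u_1 = (\beta p/\alpha)^{1/3}$, $u_2 = (\gamma p/\beta)^{1/3}$, $u_3 = (2(1+2^{1/3}+2^{2/3}))^{1/3}$, $u_4 = (\alpha p/\gamma)^{1/3}$. Then $$\frac{\varphi(e^{-81\pi\sqrt3})}{\varphi(e^{-\pi\sqrt3})} = \frac19(1+u_1+u_2+u_3+u_4).$$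
   Context: $\varphi(q) := \sum_{n=-\infty}^\infty q^{n^2}$ for $|q|<1$. Cube roots of real numbers denote real cube roots. *)

theory Defs
  imports "HOL-Analysis.Analysis"
begin

text \<open>Ramanujan's theta function. For \<open>norm q < 1\<close> the two-sided series converges absolutely,
  so the unordered sum is the usual one; no meaning is attached to other arguments.\<close>

definition phi :: "'a::{real_normed_field, banach} \<Rightarrow> 'a" where
  "phi q = (\<Sum>\<^sub>\<infinity>n\<in>(UNIV :: int set). q powi (n ^ 2))"

end

theory Submission
  imports Defs "HOL-Probability.Probability"
begin

text \<open>Let \<open>q = exp (- pi * sqrt 3)\<close> and \<open>x r = (\<Sum>n. q ^ n\<^sup>2 * cos (2 * pi * n * r / 9))\<close>. Orthogonality of the ninth
  roots of unity gives \<open>9 * phi (q ^ 81) = x 0 + 2 * (x 1 + x 2 + x 3 + x 4)\<close>, so the claim is that the given cube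
  roots are the ratios \<open>u r = 2 * x r / x 0\<close>. Since \<open>u 2 * (u 4)\<^sup>2\<close>, \<open>u 4 * (u 1)\<^sup>2\<close>, \<open>u 1 * (u 2)\<^sup>2\<close> determine these
  ratios together with \<open>u 1 * u 2 * u 4\<close>, it suffices to identify them with \<open>\<alpha>\<close>, \<open>\<beta>\<close>, \<open>\<gamma>\<close>.

  Products of three theta functions whose arguments differ by cube roots of unity are multiples of one theta
  function of nome \<open>q ^ 3\<close>, the factor being a sum over the lattice \<open>m1 + m2 + m3 = 0\<close>. Comparing these at
  different arguments expresses the elementary symmetric functions of the three quantities through \<open>u 3\<close>,
  and eliminating the lattice sums gives the cubic modular equation
  \<open>9 * phi (q ^ 3) ^ 4 = phi q ^ 4 * (1 + (u 3) ^ 3)\<close>. Applied at \<open>exp (- pi / sqrt 3)\<close> and at its cube \<open>q\<close>, and combined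
  with the inversion formula for \<open>phi\<close>, it yields the value of \<open>u 3\<close>. Finally \<open>\<alpha>\<close>, \<open>\<beta>\<close>, \<open>\<gamma>\<close> have the same elementary
  symmetric functions, and numerical bounds show that both triples are increasing.\<close>

subsection \<open>Products of three theta series\<close>

lemma range_int_Un_negative: "range int \<union> range (\<lambda>n. - 1 - int n) = UNIV"
proof -
  have "x \<in> range int \<union> range (\<lambda>n. - 1 - int n)" for x
  proof (cases "x \<ge> 0")
    case True then show ?thesis by (auto intro: range_eqI[of _ _ "nat x"])
  next
    case False
    then have "x = - 1 - int (nat (- 1 - x))" by simp
    then show ?thesis by blast
  qed
  then show ?thesis by blast
qed

lemma summable_on_powi_abs:
  fixes q :: real
  assumes "0 < q" "q < 1"
  shows "(\<lambda>n::int. q powi \<bar>n\<bar>) summable_on UNIV"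
proof -
  have s: "(\<lambda>n::nat. q ^ n) summable_on UNIV"
    using assms by (intro norm_summable_imp_summable_on) (auto intro: summable_geometric)
  have 1: "(\<lambda>n::int. q powi \<bar>n\<bar>) summable_on range int"
    by (subst summable_on_reindex) (use s in \<open>auto simp: o_def inj_on_def\<close>)
  have "(\<lambda>n::nat. q * q ^ n) summable_on UNIV"
    using s by (rule summable_on_cmult_right)
  moreover have "(\<lambda>n::nat. q powi \<bar>- 1 - int n\<bar>) = (\<lambda>n. q * q ^ n)"
  proof
    fix n :: nat
    have "\<bar>- 1 - int n\<bar> = int (Suc n)" by simp
    then show "q powi \<bar>- 1 - int n\<bar> = q * q ^ n" by (simp only: power_int_of_nat power_Suc)
  qed
  ultimately have 2: "(\<lambda>n::int. q powi \<bar>n\<bar>) summable_on range (\<lambda>n. - 1 - int n)"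
    by (subst summable_on_reindex) (auto simp: o_def inj_on_def)
  have "range int \<inter> range (\<lambda>n. - 1 - int n) = {}" by auto
  from summable_on_Un_disjoint[OF 1 2 this] show ?thesis by (simp add: range_int_Un_negative)
qed

lemma summable_on_powi_square:
  fixes q :: real
  assumes "0 < q" "q < 1"
  shows "(\<lambda>n::int. q powi n\<^sup>2) summable_on UNIV"
proof (rule summable_on_comparison_test[OF summable_on_powi_abs[OF assms]])
  fix n :: int
  have "\<bar>n\<bar> \<le> n\<^sup>2"
    by (metis abs_le_square_iff abs_of_nonneg abs_ge_zero int_one_le_iff_zero_less linorder_not_le
        mult.right_neutral mult_left_mono nless_le power2_abs power2_eq_square zero_less_abs_iff mult_zero_left)
  then show "q powi n\<^sup>2 \<le> q powi \<bar>n\<bar>"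
    using assms by (intro power_int_decreasing) auto
qed (use assms in auto)

lemma
  fixes f :: "'i \<Rightarrow> 'a :: {real_normed_field, banach}" and g :: "'j \<Rightarrow> 'a"
  assumes f: "(\<lambda>x. norm (f x)) summable_on A" and g: "(\<lambda>y. norm (g y)) summable_on B"
  shows norm_summable_on_product: "(\<lambda>(x, y). norm (f x * g y)) summable_on (A \<times> B)"
    and has_sum_product: "(f has_sum a) A \<Longrightarrow> (g has_sum b) B \<Longrightarrow>
           ((\<lambda>(x, y). f x * g y) has_sum (a * b)) (A \<times> B)"
proof -
  have "(\<lambda>p. norm ((\<lambda>(x, y). f x * g y) p)) summable_on (A \<times> B)"
    by (rule iffD2[OF Infinite_Sum.abs_summable_on_Sigma_iff])
      (use f g in \<open>auto simp: norm_mult infsum_cmult_right' abs_mult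
        intro!: summable_on_cmult_right summable_on_cmult_left\<close>)
  then show *: "(\<lambda>(x, y). norm (f x * g y)) summable_on (A \<times> B)"
    by (simp add: case_prod_unfold)
  assume a: "(f has_sum a) A" and b: "(g has_sum b) B"
  show "((\<lambda>(x, y). f x * g y) has_sum (a * b)) (A \<times> B)"
  proof (rule has_sum_SigmaI)
    show "((\<lambda>y. (\<lambda>(x, y). f x * g y) (x, y)) has_sum (f x * b)) B" for x
      using has_sum_cmult_right[OF b] by simp
    show "((\<lambda>x. f x * b) has_sum (a * b)) A" using has_sum_cmult_left[OF a] .
    show "(\<lambda>(x, y). f x * g y) summable_on (A \<times> B)"
      using * by (intro abs_summable_summable[of "\<lambda>(x, y). f x * g y"]) (simp add: case_prod_unfold)
  qed
qed

text \<open>Jacobi's theta_3 of nome \<open>q\<close> in the multiplicative variable w = exp (2 i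
  z). For |w| = 1 each term has the modulus of the corresponding term of
  \<open>phi q\<close>.\<close>

definition theta :: "real \<Rightarrow> complex \<Rightarrow> complex" where
  "theta q w = (\<Sum>\<^sub>\<infinity>n\<in>UNIV. of_real (q powi n\<^sup>2) * w powi n)"

lemma norm_theta_term:
  assumes "0 < q" "norm w = 1"
  shows "norm (complex_of_real (q powi n\<^sup>2) * w powi n) = q powi n\<^sup>2"
  using assms by (simp add: norm_mult norm_power_int del: of_real_power_int)

lemma
  assumes "0 < q" "q < 1" "norm w = 1"
  shows theta_abs_summable:
      "(\<lambda>n::int. norm (complex_of_real (q powi n\<^sup>2) * w powi n)) summable_on UNIV"
    and theta_has_sum: "((\<lambda>n. of_real (q powi n\<^sup>2) * w powi n) has_sum theta q w) UNIV"
proof -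
  show *: "(\<lambda>n::int. norm (complex_of_real (q powi n\<^sup>2) * w powi n)) summable_on UNIV"
    using assms by (simp only: norm_theta_term summable_on_powi_square)
  then show "((\<lambda>n. of_real (q powi n\<^sup>2) * w powi n) has_sum theta q w) UNIV"
    unfolding theta_def by (rule has_sum_infsum[OF abs_summable_summable])
qed

section \<open>The primitive cube root of unity and the divisibility filter it provides\<close>

definition \<omega> :: complex where "\<omega> = cis (2 * pi / 3)"

lemma norm_omega [simp]: "norm \<omega> = 1" and omega_neq_0 [simp]: "\<omega> \<noteq> 0"
  and omega_cube: "\<omega> ^ 3 = 1"
  by (simp_all add: \<omega>_def Complex.DeMoivre)

lemma omega_eq: "\<omega> = Complex (-1/2) (sqrt 3 / 2)"
  by (simp add: \<omega>_def cis.code cos_120 sin_120)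


lemma omega_sum: "1 + \<omega> + \<omega>\<^sup>2 = 0"
  by (simp add: omega_eq complex_eq_iff power2_eq_square)

lemma omega_powi_mod: "\<omega> powi n = \<omega> powi (n mod 3)"
proof -
  have "\<omega> powi n = \<omega> powi (3 * (n div 3) + n mod 3)" by simp
  also have "\<dots> = (\<omega> powi 3) powi (n div 3) * \<omega> powi (n mod 3)"
    by (simp only: power_int_add omega_neq_0 power_int_mult simp_thms)
  also have "\<omega> powi 3 = 1" using omega_cube by (simp add: power_int_numeral)
  finally show ?thesis by simp
qed

lemma omega_powi_cong: "m mod 3 = n mod 3 \<Longrightarrow> \<omega> powi m = \<omega> powi n"
  by (metis omega_powi_mod)

text \<open>This geometric sum is the filter that retains index combinations divisible by 3, both in
  triple products and in lattice sums.\<close>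

lemma omega_powi_sum: "1 + \<omega> powi n + \<omega> powi (2 * n) = (if 3 dvd n then 3 else 0)"
proof -
  have "n mod 3 = 0 \<or> n mod 3 = 1 \<or> n mod 3 = 2" by presburger
  then consider "n mod 3 = 0" | "n mod 3 = 1" | "n mod 3 = 2" by blast
  then show ?thesis
  proof cases
    case 1
    have "n mod 3 = 0 mod 3" using 1 by presburger
    moreover have "2 * n mod 3 = 0 mod 3"
      using 1 mod_mult_right_eq[of 2 n 3] by simp
    ultimately have "\<omega> powi n = \<omega> powi 0" "\<omega> powi (2 * n) = \<omega> powi 0"
      using omega_powi_cong by blast+
    with 1 show ?thesis by (auto simp: dvd_eq_mod_eq_0)
  next
    case 2
    have "n mod 3 = 1 mod 3" using 2 by presburger
    moreover have "2 * n mod 3 = 2 mod 3"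
      using 2 mod_mult_right_eq[of 2 n 3] by simp
    ultimately have "\<omega> powi n = \<omega> powi 1" "\<omega> powi (2 * n) = \<omega> powi 2"
      using omega_powi_cong by blast+
    with 2 omega_sum show ?thesis by (auto simp: dvd_eq_mod_eq_0 power_int_numeral)
  next
    case 3
    have "n mod 3 = 2 mod 3" using 3 by presburger
    moreover have "2 * n mod 3 = 1 mod 3"
      using 3 mod_mult_right_eq[of 2 n 3] by simp
    ultimately have "\<omega> powi n = \<omega> powi 2" "\<omega> powi (2 * n) = \<omega> powi 1"
      using omega_powi_cong by blast+
    with 3 omega_sum show ?thesis by (auto simp: dvd_eq_mod_eq_0 power_int_numeral algebra_simps)
  qed
qed

text \<open>The sum over the integer triples \<open>(m1, m2, m3)\<close> with \<open>m1 + m2 + m3 = 0\<close> of \<open>q\<close> to the squared length times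
  \<open>\<omega>\<close> to the power \<open>e1 m1 + e2 m2 + e3 m3\<close>, parametrised by \<open>i = m1\<close> and \<open>j = m2\<close>.\<close>
definition lat :: "real \<Rightarrow> int \<Rightarrow> int \<Rightarrow> int \<Rightarrow> complex" where
  "lat q e1 e2 e3 = (\<Sum>\<^sub>\<infinity>(i, j)\<in>UNIV. of_real (q powi (i\<^sup>2 + j\<^sup>2 + (i + j)\<^sup>2))
     * \<omega> powi (e1 * i + e2 * j - e3 * (i + j)))"

text \<open>Dropping the square of i + j from the exponent only enlarges the terms, and the majorant
  is a product of two one-dimensional series.\<close>

lemma powi_lattice_summable:
  fixes q :: real
  assumes "0 < q" "q < 1"
  shows "(\<lambda>(i::int, j::int). q powi (i\<^sup>2 + j\<^sup>2 + (i + j)\<^sup>2)) summable_on UNIV"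
proof (rule summable_on_comparison_test)
  have "(\<lambda>n::int. norm (q powi n\<^sup>2)) summable_on UNIV"
    using assms summable_on_powi_square by simp
  from norm_summable_on_product[OF this this]
  show "(\<lambda>(x::int, y::int). norm (q powi x\<^sup>2 * q powi y\<^sup>2)) summable_on UNIV" by simp
qed (use assms in \<open>auto simp: norm_mult power_int_add[symmetric] intro!: power_int_decreasing\<close>)

lemma
  assumes "0 < q" "q < 1"
  shows lat_abs_summable: "(\<lambda>(i::int, j::int). norm (of_real (q powi (i\<^sup>2 + j\<^sup>2 + (i + j)\<^sup>2))
     * \<omega> powi (e1 * i + e2 * j - e3 * (i + j)))) summable_on UNIV"
   and lat_has_sum: "((\<lambda>(i, j). of_real (q powi (i\<^sup>2 + j\<^sup>2 + (i + j)\<^sup>2))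
     * \<omega> powi (e1 * i + e2 * j - e3 * (i + j))) has_sum lat q e1 e2 e3) UNIV"
proof -
  show *: "(\<lambda>(i::int, j::int). norm (of_real (q powi (i\<^sup>2 + j\<^sup>2 + (i + j)\<^sup>2))
     * \<omega> powi (e1 * i + e2 * j - e3 * (i + j)))) summable_on UNIV"
    using powi_lattice_summable[OF assms] assms
    by (simp add: norm_mult norm_power_int del: of_real_power_int)
  show "((\<lambda>(i, j). of_real (q powi (i\<^sup>2 + j\<^sup>2 + (i + j)\<^sup>2))
     * \<omega> powi (e1 * i + e2 * j - e3 * (i + j))) has_sum lat q e1 e2 e3) UNIV"
    unfolding lat_def using *
    by (intro has_sum_infsum) (rule abs_summable_summable, simp add: case_prod_unfold)
qed

text \<open>The power of \<open>\<omega>\<close> is kept apart from that of \<open>w\<close>: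
  raising all three exponents by one then multiplies each term by \<open>\<omega>\<close> to the
  index sum.\<close>

lemma theta_triple_has_sum:
  assumes q: "0 < q" "q < 1" and w: "norm w = 1"
  shows "((\<lambda>(a, b, c). of_real (q powi (a\<^sup>2 + b\<^sup>2 + c\<^sup>2)) * w powi (a + b + c)
            * \<omega> powi (e1 * a + e2 * b + e3 * c)) has_sum
          (theta q (w * \<omega> powi e1) * (theta q (w * \<omega> powi e2) * theta q (w * \<omega> powi e3)))) UNIV"
proof -
  have n: "norm (w * \<omega> powi e) = 1" for e using w by (simp add: norm_mult norm_power_int)
  note ab = theta_abs_summable[OF q n] and hs = theta_has_sum[OF q n]
  have nz: "w \<noteq> 0" using w by auto
  have s: "(\<lambda>y. norm ((\<lambda>(b, c). (of_real (q powi b\<^sup>2) * (w * \<omega> powi e2) powi b) *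
          (complex_of_real (q powi c\<^sup>2) * (w * \<omega> powi e3) powi c)) y)) summable_on (UNIV \<times> UNIV)"
    using norm_summable_on_product[OF ab[of e2] ab[of e3]] by (simp only: case_prod_unfold)
  have "((\<lambda>(a, b, c). (of_real (q powi a\<^sup>2) * (w * \<omega> powi e1) powi a) *
          ((of_real (q powi b\<^sup>2) * (w * \<omega> powi e2) powi b) *
          (of_real (q powi c\<^sup>2) * (w * \<omega> powi e3) powi c))) has_sum
        (theta q (w * \<omega> powi e1) * (theta q (w * \<omega> powi e2) * theta q (w * \<omega> powi e3)))) 
        (UNIV \<times> (UNIV \<times> UNIV))"
    using has_sum_product[OF ab s hs has_sum_product[OF ab ab hs hs]]
    by (simp only: case_prod_unfold)
  moreover have "(of_real (q powi a\<^sup>2) * (w * \<omega> powi e1) powi a) *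
          ((of_real (q powi b\<^sup>2) * (w * \<omega> powi e2) powi b) *
          (of_real (q powi c\<^sup>2) * (w * \<omega> powi e3) powi c)) = 
     of_real (q powi (a\<^sup>2 + b\<^sup>2 + c\<^sup>2)) * w powi (a + b + c) * \<omega> powi (e1 * a + e2 * b + e3 * c)" for a b c
  proof -
    have 1: "(w * \<omega> powi e) powi n = w powi n * \<omega> powi (e * n)" for e n
      by (simp add: power_int_mult_distrib power_int_mult)
    have 2: "q powi (a\<^sup>2 + b\<^sup>2 + c\<^sup>2) = q powi a\<^sup>2 * q powi b\<^sup>2 * q powi c\<^sup>2"
      "w powi (a + b + c) = w powi a * w powi b * w powi c"
      "\<omega> powi (e1 * a + e2 * b + e3 * c) = \<omega> powi (e1 * a) * \<omega> powi (e2 * b) * \<omega> powi (e3 * c)"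
      using nz q by (simp_all add: power_int_add)
    show ?thesis unfolding 1 2 of_real_mult by (simp only: mult_ac)
  qed
  ultimately show ?thesis by simp
qed

text \<open>Summing over a common shift of the three arguments by \<open>\<omega> ^ j\<close> keeps the terms whose index sum
  \<open>s = n1 + n2 + n3\<close> is divisible by 3; subtracting \<open>s / 3\<close> from each index separates the variables.\<close>
lemma theta_triple_product:
  assumes q: "0 < q" "q < 1" and w: "norm w = 1"
  shows "(\<Sum>j\<in>{0,1,2}. theta q (w * \<omega> powi (e1 + j)) * theta q (w * \<omega> powi (e2 + j)) * theta q (w * \<omega> powi (e3 + j)))
    = 3 * lat q e1 e2 e3 * theta (q ^ 3) (w ^ 3 * \<omega> powi (e1 + e2 + e3))" (is "?L = ?R")
proof -
  let ?g = "\<lambda>(a, b, c). of_real (q powi (a\<^sup>2 + b\<^sup>2 + c\<^sup>2)) * w powi (a + b + c)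
            * \<omega> powi (e1 * a + e2 * b + e3 * c) * (if 3 dvd a + b + c then 3 else (0::complex))"
  have nz: "w \<noteq> 0" using w by auto
  have q3: "0 < q ^ 3" "q ^ 3 < 1" using q by (auto simp: power_less_one_iff)
  have ww: "norm (w ^ 3 * \<omega> powi (e1 + e2 + e3)) = 1" using w by (simp add: norm_mult norm_power norm_power_int)
  have eq: "(\<lambda>p. (case p of (a, b, c) \<Rightarrow> of_real (q powi (a\<^sup>2 + b\<^sup>2 + c\<^sup>2)) * w powi (a + b + c)
            * \<omega> powi (e1 * a + e2 * b + e3 * c)) + (case p of (a, b, c) \<Rightarrow> of_real (q powi (a\<^sup>2 + b\<^sup>2 + c\<^sup>2)) * w powi (a + b + c)
            * \<omega> powi ((e1+1) * a + (e2+1) * b + (e3+1) * c)) + (case p of (a, b, c) \<Rightarrow> of_real (q powi (a\<^sup>2 + b\<^sup>2 + c\<^sup>2)) * w powi (a + b + c)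
            * \<omega> powi ((e1+2) * a + (e2+2) * b + (e3+2) * c))) = ?g"
  proof (rule ext, clarify)
    fix a b c :: int
    have 1: "\<omega> powi ((e1+1) * a + (e2+1) * b + (e3+1) * c) = \<omega> powi (e1 * a + e2 * b + e3 * c) * \<omega> powi (a+b+c)"
      by (simp add: power_int_add[symmetric] algebra_simps)
    have 2: "\<omega> powi ((e1+2) * a + (e2+2) * b + (e3+2) * c) = \<omega> powi (e1 * a + e2 * b + e3 * c) * \<omega> powi (2*(a+b+c))"
      by (simp add: power_int_add[symmetric] algebra_simps)
    show "of_real (q powi (a\<^sup>2 + b\<^sup>2 + c\<^sup>2)) * w powi (a + b + c)
            * \<omega> powi (e1 * a + e2 * b + e3 * c) + of_real (q powi (a\<^sup>2 + b\<^sup>2 + c\<^sup>2)) * w powi (a + b + c)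
            * \<omega> powi ((e1+1) * a + (e2+1) * b + (e3+1) * c) + of_real (q powi (a\<^sup>2 + b\<^sup>2 + c\<^sup>2)) * w powi (a + b + c)
            * \<omega> powi ((e1+2) * a + (e2+2) * b + (e3+2) * c) = of_real (q powi (a\<^sup>2 + b\<^sup>2 + c\<^sup>2)) * w powi (a + b + c)
            * \<omega> powi (e1 * a + e2 * b + e3 * c) * (if 3 dvd a + b + c then 3 else (0::complex))"
      unfolding 1 2 omega_powi_sum[symmetric] by (simp add: algebra_simps)
  qed
  have "(?g has_sum ?L) UNIV"
    using has_sum_add[OF has_sum_add[OF theta_triple_has_sum[OF q w, of e1 e2 e3] 
       theta_triple_has_sum[OF q w, of "e1+1" "e2+1" "e3+1"]] theta_triple_has_sum[OF q w, of "e1+2" "e2+2" "e3+2"]]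
    unfolding eq by (simp add: mult.assoc add.assoc)
  also have "?this \<longleftrightarrow> (?g has_sum ?L) {(a,b,c). 3 dvd a + b + c}"
    by (rule has_sum_cong_neutral) auto
  finally have L: "(?g has_sum ?L) {(a,b,c). 3 dvd a + b + c}" .
  let ?h = "\<lambda>((i, j), k). of_real (q powi (i\<^sup>2 + j\<^sup>2 + (i + j)\<^sup>2))
     * \<omega> powi (e1 * i + e2 * j - e3 * (i + j)) * 
      (of_real ((q ^ 3) powi k\<^sup>2) * (w ^ 3 * \<omega> powi (e1 + e2 + e3)) powi k)"
  have s: "(\<lambda>y. norm ((\<lambda>(i,j). of_real (q powi (i\<^sup>2 + j\<^sup>2 + (i + j)\<^sup>2))
     * \<omega> powi (e1 * i + e2 * j - e3 * (i + j))) y)) summable_on UNIV"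
    using lat_abs_summable[OF q] by (simp only: case_prod_unfold)
  \<comment> \<open>Write the index triple as (i, j, -i-j) plus k in each entry. As the first triple
    sums to zero, the cross terms of the squared length cancel and 3 k^2 remains; hence the separate
    theta factor has nome \<open>q ^ 3\<close>.\<close>
  have key: "?g (case x of ((i, j), k) \<Rightarrow> (i + k, j + k, k - i - j)) = 3 * ?h x" for x :: "(int \<times> int) \<times> int"
  proof -
    obtain i j k where x: "x = ((i, j), k)" by (metis surj_pair)
    have 1: "(i + k)\<^sup>2 + (j + k)\<^sup>2 + (k - i - j)\<^sup>2 = (i\<^sup>2 + j\<^sup>2 + (i + j)\<^sup>2) + 3 * k\<^sup>2"
      by (simp add: power2_eq_square algebra_simps)
    have 2: "e1 * (i + k) + e2 * (j + k) + e3 * (k - i - j) = (e1 * i + e2 * j - e3 * (i + j)) + (e1 + e2 + e3) * k"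
      by (simp add: algebra_simps)
    have 3: "(i + k) + (j + k) + (k - i - j) = 3 * k" by simp
    have 4: "(q ^ 3) powi k\<^sup>2 = q powi (3 * k\<^sup>2)"
      by (simp add: power_int_mult)
    have 5: "(w ^ 3 * \<omega> powi (e1 + e2 + e3)) powi k = w powi (3 * k) * \<omega> powi ((e1 + e2 + e3) * k)"
      by (simp add: power_int_mult_distrib power_int_mult)
    have 6: "q powi (i\<^sup>2 + j\<^sup>2 + (i + j)\<^sup>2 + 3 * k\<^sup>2) = q powi (i\<^sup>2 + j\<^sup>2 + (i + j)\<^sup>2) * q powi (3 * k\<^sup>2)"
      using q by (simp add: power_int_add)
    have 7: "\<omega> powi (e1 * i + e2 * j - e3 * (i + j) + (e1 + e2 + e3) * k) =
        \<omega> powi (e1 * i + e2 * j - e3 * (i + j)) * \<omega> powi ((e1 + e2 + e3) * k)"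
      by (simp add: power_int_add)
    have 8: "(if 3 dvd 3 * k then 3 else 0 :: complex) = 3" by simp
    show "?g (case x of ((i, j), k) \<Rightarrow> (i + k, j + k, k - i - j)) = 3 * ?h x"
      unfolding x prod.case 1 2 3 4 5 6 7 8 of_real_mult by (simp only: mult_ac)
  qed
  have "(?h has_sum (lat q e1 e2 e3 * theta (q ^ 3) (w ^ 3 * \<omega> powi (e1 + e2 + e3)))) (UNIV \<times> UNIV)"
    using has_sum_product[OF s theta_abs_summable[OF q3 ww] lat_has_sum[OF q] theta_has_sum[OF q3 ww]]
    by (simp only: case_prod_unfold)
  from has_sum_cmult_right[OF this, of 3]
  have "((\<lambda>x. 3 * ?h x) has_sum ?R) UNIV" by (simp add: mult.assoc)
  also have "?this \<longleftrightarrow> (?g has_sum ?R) {(a,b,c). 3 dvd a + b + c}"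
    by (rule has_sum_reindex_bij_witness[where j = "\<lambda>((i, j), k). (i + k, j + k, k - i - j)"
        and i = "\<lambda>(a, b, c). ((a - (a + b + c) div 3, b - (a + b + c) div 3), (a + b + c) div 3)"])
      (use key in \<open>auto\<close>)
  finally have R: "(?g has_sum ?R) {(a,b,c). 3 dvd a + b + c}" .
  show ?thesis using has_sum_unique[OF L R] .
qed

section \<open>Theta values at roots of unity: reality, evenness and orthogonality\<close>

lemma phi_has_sum:
  fixes q :: real
  assumes "0 < q" "q < 1"
  shows "((\<lambda>n. q powi n\<^sup>2) has_sum phi q) UNIV"
  unfolding phi_def using summable_on_powi_square[OF assms] by (rule has_sum_infsum)

lemma theta_1:
  assumes "0 < q" "q < 1"
  shows "theta q 1 = of_real (phi q)"
proof (rule has_sum_unique)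
  show "((\<lambda>n. complex_of_real (q powi n\<^sup>2)) has_sum theta q 1) UNIV"
    using theta_has_sum[OF assms, of 1] by (simp del: of_real_power_int)
qed (rule has_sum_of_real[OF phi_has_sum[OF assms]])

lemma has_sum_finite_sum:
  fixes f :: "'i \<Rightarrow> 'b \<Rightarrow> 'a :: {topological_comm_monoid_add}"
  assumes "finite A" "\<And>i. i \<in> A \<Longrightarrow> (f i has_sum s i) B"
  shows "((\<lambda>x. \<Sum>i\<in>A. f i x) has_sum (\<Sum>i\<in>A. s i)) B"
  using assms by (induction A rule: finite_induct) (auto intro: has_sum_add)

lemma theta_inverse: "theta q (inverse w) = theta q w"
  unfolding theta_def
  by (rule infsum_reindex_bij_witness[where i = uminus and j = uminus])
     (auto simp: power_int_minus power_int_inverse)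

lemma theta_cnj: "theta q (cnj w) = cnj (theta q w)"
  unfolding theta_def by (subst infsum_cnj[symmetric]) (simp add: complex_cnj_power_int)

text \<open>On the unit circle conjugation is inversion, and the series is even under n -> -n, so
  the value equals its own conjugate.\<close>

lemma theta_cis_real: "theta q (cis x) = of_real (Re (theta q (cis x)))"
proof -
  have "cnj (theta q (cis x)) = theta q (cis x)"
    using theta_cnj[of q "cis x"] theta_inverse[of q "cis x"] by (simp add: cis_cnj cis_inverse)
  then show ?thesis by (metis Reals_cnj_iff of_real_Re)
qed

lemma sum_roots_of_unity_powi:
  assumes "m > 0"
  shows "(\<Sum>r<m. cis (2 * pi * real r / real m) powi n) = (if int m dvd n then of_nat m else 0)"
proof -
  let ?z = "cis (2 * pi * of_int n / real m)"
  \<comment> \<open>Exchanging the roles of r and n turns the sum into a geometric one with ratio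
    \<open>?z\<close>.\<close>
  have eq: "cis (2 * pi * real r / real m) powi n = ?z ^ r" for r
    by (simp add: cis_power_int Complex.DeMoivre field_simps)
  have "?z ^ m = cis (2 * pi * of_int n)" using assms by (simp add: Complex.DeMoivre)
  also have "\<dots> = 1" by (simp add: complex_eq_iff cos_int_2pin sin_int_2pin)
  finally have zm: "?z ^ m = 1" .
  show ?thesis
  proof (cases "int m dvd n")
    case True
    then obtain k where "n = int m * k" by auto
    then have "2 * pi * of_int n / real m = 2 * pi * of_int k" using assms by simp
    then have "?z = 1" by (simp only: complex_eq_iff cis.sel cos_int_2pin sin_int_2pin one_complex.sel simp_thms)
    with True show ?thesis unfolding eq by simp
  next
    case False
    have "?z \<noteq> 1"
    proof
      assume "?z = 1"
      then have "cos (2 * pi * of_int n / real m) = 1" by (simp add: complex_eq_iff)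
      then obtain k :: int where "2 * pi * of_int n / real m = of_int k * 2 * pi"
        by (auto simp: cos_one_2pi_int)
      then have "real_of_int n = of_int (int m * k)" using assms by (simp add: field_simps)
      then have "n = int m * k" by (simp only: of_int_eq_iff)
      with False show False by simp
    qed
    then show ?thesis unfolding eq using False zm by (simp add: geometric_sum)
  qed
qed

text \<open>Only the indices n = m k survive the summation, and their exponents m^2 k^2 produce the
  new nome. The case m = 9 yields the nome \<open>q ^ 81\<close>, the case m = 3 the trisection with
  \<open>q ^ 9\<close>.\<close>

lemma sum_theta_roots_of_unity:
  assumes q: "0 < q" "q < 1" and m: "m > 0"
  shows "(\<Sum>r<m. theta q (cis (2 * pi * real r / real m))) = of_nat m * of_real (phi (q ^ m\<^sup>2))"
proof -
  have "((\<lambda>n. \<Sum>r<m. of_real (q powi n\<^sup>2) * cis (2 * pi * real r / real m) powi n) has_sum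
      (\<Sum>r<m. theta q (cis (2 * pi * real r / real m)))) UNIV"
    by (intro has_sum_finite_sum theta_has_sum q) auto
  also have "?this \<longleftrightarrow> ((\<lambda>n. of_real (q powi n\<^sup>2) * of_nat m) has_sum
      (\<Sum>r<m. theta q (cis (2 * pi * real r / real m)))) {n. int m dvd n}"
    unfolding sum_distrib_left[symmetric] sum_roots_of_unity_powi[OF m]
    by (rule has_sum_cong_neutral) auto
  also have "\<dots> \<longleftrightarrow> ((\<lambda>n. of_real ((q ^ m\<^sup>2) powi n\<^sup>2) * of_nat m) has_sum
      (\<Sum>r<m. theta q (cis (2 * pi * real r / real m)))) UNIV"
  proof (rule has_sum_reindex_bij_witness[where i = "\<lambda>k. int m * k" and j = "\<lambda>n. n div int m"])
    fix a assume "a \<in> {n. int m dvd n}"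
    then obtain k where a: "a = int m * k" by auto
    have 1: "(a div int m)\<^sup>2 = k\<^sup>2" using a m by simp
    have 2: "a\<^sup>2 = int (m\<^sup>2) * k\<^sup>2" using a by (simp add: power_mult_distrib)
    show "of_real ((q ^ m\<^sup>2) powi (a div int m)\<^sup>2) * of_nat m = complex_of_real (q powi a\<^sup>2) * of_nat m"
      unfolding 1 2 power_int_mult power_int_of_nat ..
  qed (use m in auto)
  finally have 1: "((\<lambda>n. of_real ((q ^ m\<^sup>2) powi n\<^sup>2) * of_nat m) has_sum
      (\<Sum>r<m. theta q (cis (2 * pi * real r / real m)))) UNIV" .
  have "0 < q ^ m\<^sup>2" "q ^ m\<^sup>2 < 1" using q m by (auto simp: power_less_one_iff)
  from has_sum_of_real[OF phi_has_sum[OF this]]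
  have "((\<lambda>n. complex_of_real ((q ^ m\<^sup>2) powi n\<^sup>2)) has_sum of_real (phi (q ^ m\<^sup>2))) UNIV" .
  from has_sum_cmult_left[OF this, of "of_nat m"] has_sum_unique[OF 1] show ?thesis
    by (simp add: mult.commute)
qed

text \<open>The map (i, j) -> (i + 2j, i - j) is a similarity of the hexagonal lattice that triples
  the quadratic form; its image is exactly the sublattice i = j mod 3.\<close>

lemma sublattice_has_sum:
  "((\<lambda>(i, j). of_real (q powi (i\<^sup>2 + j\<^sup>2 + (i + j)\<^sup>2)) * f i j) has_sum S) {(i, j). 3 dvd i - j} \<longleftrightarrow>
   ((\<lambda>(i, j). of_real ((q ^ 3) powi (i\<^sup>2 + j\<^sup>2 + (i + j)\<^sup>2)) * f (i + 2 * j) (i - j)) has_sum S) UNIV"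
  for q :: real and f :: "int \<Rightarrow> int \<Rightarrow> complex"
proof (rule has_sum_reindex_bij_witness[where i = "\<lambda>(i, j). (i + 2 * j, i - j)"
      and j = "\<lambda>(i, j). (j + (i - j) div 3, (i - j) div 3)"])
  fix a :: "int \<times> int" assume "a \<in> {(i, j). 3 dvd i - j}"
  then obtain i j k where a: "a = (i, j)" "i - j = 3 * k" by auto
  then have i: "i = j + 3 * k" by simp
  have 1: "3 * ((j + k)\<^sup>2 + k\<^sup>2 + (j + k + k)\<^sup>2) = i\<^sup>2 + j\<^sup>2 + (i + j)\<^sup>2"
    unfolding i by (simp add: power2_eq_square algebra_simps)
  have 2: "(q ^ 3) powi n = q powi (3 * n)" for n :: int by (simp add: power_int_mult)
  have 3: "(i - j) div 3 = k" using a by simp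
  show "(case case a of (i, j) \<Rightarrow> (j + (i - j) div 3, (i - j) div 3) of (i, j) \<Rightarrow>
      of_real ((q ^ 3) powi (i\<^sup>2 + j\<^sup>2 + (i + j)\<^sup>2)) * f (i + 2 * j) (i - j)) =
    (case a of (i, j) \<Rightarrow> of_real (q powi (i\<^sup>2 + j\<^sup>2 + (i + j)\<^sup>2)) * f i j)"
    unfolding a(1) prod.case 3 2 1 by (simp add: i add_ac)
qed auto

text \<open>\<open>lat q 0 0 0\<close> and \<open>lat q 0 1 2\<close> are a(q^2) and b(q^2) for the
  cubic theta functions a, b of the Borweins. The character of \<open>lat q 0 1 2\<close> is
  \<open>\<omega>\<close> to the power i - j, and swapping i and j gives the inverse character the
  same sum. Adding both to the trivial character leaves three times the sum over the sublattice i =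
  j mod 3.\<close>

lemma lat_012:
  assumes q: "0 < q" "q < 1"
  shows "2 * lat q 0 1 2 = 3 * lat (q ^ 3) 0 0 0 - lat q 0 0 0"
proof -
  let ?c = "\<lambda>i j. complex_of_real (q powi (i\<^sup>2 + j\<^sup>2 + (i + j)\<^sup>2))"
  have q3: "0 < q ^ 3" "q ^ 3 < 1" using q by (auto simp: power_less_one_iff)
  have 0: "((\<lambda>(i, j). ?c i j) has_sum lat q 0 0 0) UNIV"
    using lat_has_sum[OF q, of 0 0 0] by simp
  have 1: "((\<lambda>(i, j). ?c i j * \<omega> powi (i - j)) has_sum lat q 0 1 2) UNIV"
  proof -
    have "\<omega> powi (0 * i + 1 * j - 2 * (i + j)) = \<omega> powi (i - j)" for i j
      by (rule omega_powi_cong) presburger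
    with lat_has_sum[OF q, of 0 1 2] show ?thesis by simp
  qed
  have 2: "((\<lambda>(i, j). ?c i j * \<omega> powi (2 * (i - j))) has_sum lat q 0 1 2) UNIV"
  proof -
    have *: "\<omega> powi (2 * (i - j)) = \<omega> powi (j - i)" for i j
      by (rule omega_powi_cong) presburger
    have "((\<lambda>(i, j). ?c i j * \<omega> powi (j - i)) has_sum lat q 0 1 2) UNIV \<longleftrightarrow>
       ((\<lambda>(i, j). ?c i j * \<omega> powi (i - j)) has_sum lat q 0 1 2) UNIV"
      by (rule has_sum_reindex_bij_witness[where i = "\<lambda>(i, j). (j, i)" and j = "\<lambda>(i, j). (j, i)"])
         (auto simp: add_ac)
    with 1 show ?thesis unfolding * by simp
  qed
  have "((\<lambda>(i, j). ?c i j * (if 3 dvd i - j then 3 else 0)) has_sum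
          (lat q 0 0 0 + lat q 0 1 2 + lat q 0 1 2)) UNIV"
    using has_sum_add[OF has_sum_add[OF 0 1] 2]
    unfolding omega_powi_sum[symmetric] by (simp add: case_prod_unfold algebra_simps)
  also have "?this \<longleftrightarrow> ((\<lambda>(i, j). ?c i j * 3) has_sum
          (lat q 0 0 0 + lat q 0 1 2 + lat q 0 1 2)) {(i, j). 3 dvd i - j}"
    by (rule has_sum_cong_neutral) auto
  also have "\<dots> \<longleftrightarrow> ((\<lambda>(i, j). of_real ((q ^ 3) powi (i\<^sup>2 + j\<^sup>2 + (i + j)\<^sup>2)) * 3) has_sum
          (lat q 0 0 0 + lat q 0 1 2 + lat q 0 1 2)) UNIV"
    by (rule sublattice_has_sum)
  finally have 3: \<dots> .
  have "((\<lambda>(i, j). of_real ((q ^ 3) powi (i\<^sup>2 + j\<^sup>2 + (i + j)\<^sup>2)) * 3) has_sum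
          (lat (q ^ 3) 0 0 0 * 3)) UNIV"
    using has_sum_cmult_left[OF lat_has_sum[OF q3, of 0 0 0], of 3] by (simp add: case_prod_unfold)
  from has_sum_unique[OF 3 this] show ?thesis by (simp add: algebra_simps)
qed

text \<open>Cyclic rotation of (i, j, -i-j) preserves the form, so the characters with exponents
  -(i+j), i and j have equal sums. Their total vanishes off the sublattice i = j mod 3, where all
  three agree; in sublattice coordinates they become the character of
  \<open>lat (q ^ 3) 0 1 2\<close>.\<close>

lemma lat_001:
  assumes q: "0 < q" "q < 1"
  shows "lat q 0 0 1 = lat (q ^ 3) 0 1 2"
proof -
  let ?c = "\<lambda>i j. complex_of_real (q powi (i\<^sup>2 + j\<^sup>2 + (i + j)\<^sup>2))"
  have q3: "0 < q ^ 3" "q ^ 3 < 1" using q by (auto simp: power_less_one_iff)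
  have 0: "((\<lambda>(i, j). ?c i j * \<omega> powi (- (i + j))) has_sum lat q 0 0 1) UNIV"
    using lat_has_sum[OF q, of 0 0 1] by simp
  have sq: "(- j - i)\<^sup>2 = (i + j)\<^sup>2" "(- i - j)\<^sup>2 = (i + j)\<^sup>2" for i j :: int
    by (simp_all add: power2_eq_square algebra_simps)
  have c: "?c j (- i - j) = ?c i j" "?c (- i - j) i = ?c i j" for i j
    by (simp_all add: sq add_ac)
  have "((\<lambda>(i, j). ?c i j * \<omega> powi (- (i + j))) has_sum lat q 0 0 1) UNIV \<longleftrightarrow>
    ((\<lambda>(i, j). ?c i j * \<omega> powi i) has_sum lat q 0 0 1) UNIV"
    by (rule has_sum_reindex_bij_witness[where j = "\<lambda>(i, j). (- i - j, i)" and i = "\<lambda>(i, j). (j, - i - j)"])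
       (auto simp: c sq add_ac simp del: of_real_power_int)
  with 0 have 1: "((\<lambda>(i, j). ?c i j * \<omega> powi i) has_sum lat q 0 0 1) UNIV" by simp
  have "((\<lambda>(i, j). ?c i j * \<omega> powi (- (i + j))) has_sum lat q 0 0 1) UNIV \<longleftrightarrow>
    ((\<lambda>(i, j). ?c i j * \<omega> powi j) has_sum lat q 0 0 1) UNIV"
    by (rule has_sum_reindex_bij_witness[where i = "\<lambda>(i, j). (- i - j, i)" and j = "\<lambda>(i, j). (j, - i - j)"])
       (auto simp: c sq add_ac simp del: of_real_power_int)
  with 0 have 2: "((\<lambda>(i, j). ?c i j * \<omega> powi j) has_sum lat q 0 0 1) UNIV" by simp
  have *: "\<omega> powi (- (i + j)) + \<omega> powi i + \<omega> powi j = (if 3 dvd i - j then 3 * \<omega> powi (- (i + j)) else 0)" for i j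
  proof -
    have a: "\<omega> powi j = \<omega> powi (- (i + j)) * \<omega> powi (i - j)"
      unfolding power_int_add[OF disjI1, OF omega_neq_0, symmetric] by (rule omega_powi_cong) presburger
    have b: "\<omega> powi i = \<omega> powi (- (i + j)) * \<omega> powi (2 * (i - j))"
      unfolding power_int_add[OF disjI1, OF omega_neq_0, symmetric] by (rule omega_powi_cong) presburger
    have "\<omega> powi (- (i + j)) + \<omega> powi i + \<omega> powi j =
      \<omega> powi (- (i + j)) * (1 + \<omega> powi (i - j) + \<omega> powi (2 * (i - j)))"
      by (simp only: a b) (simp add: algebra_simps)
    then show ?thesis unfolding omega_powi_sum by simp
  qed
  have "((\<lambda>(i, j). ?c i j * (if 3 dvd i - j then 3 * \<omega> powi (- (i + j)) else 0)) has_sum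
          (lat q 0 0 1 + lat q 0 0 1 + lat q 0 0 1)) UNIV"
    using has_sum_add[OF has_sum_add[OF 0 1] 2]
    unfolding *[symmetric] by (simp add: case_prod_unfold algebra_simps)
  also have "?this \<longleftrightarrow> ((\<lambda>(i, j). ?c i j * (3 * \<omega> powi (- (i + j)))) has_sum
          (lat q 0 0 1 + lat q 0 0 1 + lat q 0 0 1)) {(i, j). 3 dvd i - j}"
    by (rule has_sum_cong_neutral) auto
  also have "\<dots> \<longleftrightarrow> ((\<lambda>(i, j). of_real ((q ^ 3) powi (i\<^sup>2 + j\<^sup>2 + (i + j)\<^sup>2)) *
          (3 * \<omega> powi (- ((i + 2 * j) + (i - j))))) has_sum
          (lat q 0 0 1 + lat q 0 0 1 + lat q 0 0 1)) UNIV"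
    by (rule sublattice_has_sum)
  finally have 3: \<dots> .
  have e: "- ((i + 2 * j) + (i - j)) = 0 * i + 1 * j - 2 * (i + j)" for i j :: int by simp
  have "((\<lambda>(i, j). of_real ((q ^ 3) powi (i\<^sup>2 + j\<^sup>2 + (i + j)\<^sup>2)) *
          (3 * \<omega> powi (- ((i + 2 * j) + (i - j))))) has_sum (3 * lat (q ^ 3) 0 1 2)) UNIV"
    using has_sum_cmult_right[OF lat_has_sum[OF q3, of 0 1 2], of 3] unfolding e
    by (simp only: case_prod_unfold mult_ac)
  from has_sum_unique[OF 3 this] show ?thesis by simp
qed

text \<open>These are the exponent triples (0,1,2), (0,0,1) and (0,0,0). A common shift only
  permutes the factors of the first product, so its three terms coincide and the factor 3 cancels;
  it moves the second product through a cycle and the third through the three cubes.\<close>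

lemma
  assumes q: "0 < q" "q < 1" and w: "norm w = 1"
  defines "y0 \<equiv> theta q w" and "y1 \<equiv> theta q (w * \<omega>)" and "y2 \<equiv> theta q (w * \<omega>\<^sup>2)"
  shows theta_shift_product: "y0 * y1 * y2 = lat q 0 1 2 * theta (q ^ 3) (w ^ 3)"
    and theta_shift_cyclic: "y0\<^sup>2 * y1 + y1\<^sup>2 * y2 + y2\<^sup>2 * y0 = 3 * lat q 0 0 1 * theta (q ^ 3) (w ^ 3 * \<omega>)"
    and theta_shift_cubes: "y0 ^ 3 + y1 ^ 3 + y2 ^ 3 = 3 * lat q 0 0 0 * theta (q ^ 3) (w ^ 3)"
proof -
  have o: "\<omega> powi 0 = 1" "\<omega> powi 1 = \<omega>" "\<omega> powi 2 = \<omega>\<^sup>2" "\<omega> powi 3 = 1" "\<omega> powi 4 = \<omega>"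
    using omega_powi_mod[of 4] by (simp_all add: power_int_numeral omega_cube)
  have o': "\<omega> ^ 3 = 1" "\<omega> ^ 4 = \<omega>" "\<omega>\<^sup>2 * \<omega> = 1"
    using omega_cube by (simp_all add: power_numeral_reduce mult.assoc)
  note * = theta_triple_product[OF q w]
  show "y0 * y1 * y2 = lat q 0 1 2 * theta (q ^ 3) (w ^ 3)"
    using *[of 0 1 2] unfolding y0_def y1_def y2_def by (simp add: o o' mult_ac)
  show "y0\<^sup>2 * y1 + y1\<^sup>2 * y2 + y2\<^sup>2 * y0 = 3 * lat q 0 0 1 * theta (q ^ 3) (w ^ 3 * \<omega>)"
    using *[of 0 0 1] unfolding y0_def y1_def y2_def by (simp add: o o' power2_eq_square add.assoc)
  show "y0 ^ 3 + y1 ^ 3 + y2 ^ 3 = 3 * lat q 0 0 0 * theta (q ^ 3) (w ^ 3)"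
    using *[of 0 0 0] unfolding y0_def y1_def y2_def by (simp add: o power3_eq_cube add.assoc)
qed

subsection \<open>The cubic modular equation and the ninth roots of unity\<close>

lemma phi_pos:
  fixes q :: real
  assumes "0 < q" "q < 1"
  shows "phi q > 0"
proof -
  have "(\<Sum>\<^sub>\<infinity>n\<in>{0::int}. q powi n\<^sup>2) \<le> (\<Sum>\<^sub>\<infinity>n\<in>UNIV. q powi n\<^sup>2)"
    by (rule infsum_mono_neutral) (use assms summable_on_powi_square[OF assms] in auto)
  then show ?thesis by (simp add: phi_def)
qed

text \<open>The three specialisations of the triple product at \<open>q\<close> and \<open>q ^ 3\<close>, together with the relations between
  the lattice sums, form a linear system from which the lattice sums can be eliminated.\<close>
lemma
  assumes q: "0 < q" "q < 1"
  defines "x0 \<equiv> theta q 1" and "x3 \<equiv> theta q \<omega>" and "X0 \<equiv> theta (q ^ 3) 1" and "Y3 \<equiv> theta (q ^ 3) \<omega>"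
  shows theta_cubic_1: "9 * X0 * Y3 ^ 3 = x3 * (x0\<^sup>2 + x0 * x3 + x3\<^sup>2) * (x0 + 2 * x3)"
    and theta_cubic_2: "9 * X0 ^ 4 = x0 * (x0 ^ 3 + 8 * x3 ^ 3)"
    and theta_trisection: "3 * of_real (phi (q ^ 9)) = x0 + 2 * x3"
proof -
  have q3: "0 < q ^ 3" "q ^ 3 < 1" using q by (auto simp: power_less_one_iff)
  have q9: "(q ^ 3) ^ 3 = q ^ 9" by simp
  have iw: "\<omega>\<^sup>2 = inverse \<omega>"
    using omega_cube by (simp add: field_simps power2_eq_square power3_eq_cube)
  have w2: "theta p (\<omega>\<^sup>2) = theta p \<omega>" for p unfolding iw by (rule theta_inverse)
  define Z where "Z = theta (q ^ 9) 1"
  have "q ^ 9 < 1" "0 < q ^ 9" using q by (auto simp: power_less_one_iff)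
  then have Z': "Z = of_real (phi (q ^ 9))" by (simp add: Z_def theta_1)
  have s: "{..<3::nat} = {0, 1, 2}" by auto
  have c: "cis (4 * pi / 3) = \<omega>\<^sup>2" by (simp add: \<omega>_def Complex.DeMoivre)
  have "x0 + (x3 + theta q (\<omega>\<^sup>2)) = 3 * Z"
    using sum_theta_roots_of_unity[OF q, of 3] unfolding x0_def x3_def Z'
    by (simp add: s \<omega>_def[symmetric] c)
  then have Z: "3 * Z = x0 + 2 * x3" unfolding w2 x3_def by simp
  then show "3 * of_real (phi (q ^ 9)) = x0 + 2 * x3" unfolding Z' .
  have n: "norm (1::complex) = 1" by simp
  note p = theta_shift_product[OF q n, unfolded mult_1_left power_one w2]
      theta_shift_product[OF q3 n, unfolded mult_1_left power_one w2]
    and t = theta_shift_cyclic[OF q n, unfolded mult_1_left power_one w2]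
    and g = theta_shift_cubes[OF q n, unfolded mult_1_left power_one w2]
      theta_shift_cubes[OF q3 n, unfolded mult_1_left power_one w2]
  have 1: "x0 * x3\<^sup>2 = lat q 0 1 2 * X0" using p(1)
    by (simp add: x0_def x3_def X0_def power2_eq_square mult.assoc)
  have 2: "x0 ^ 3 + 2 * x3 ^ 3 = 3 * lat q 0 0 0 * X0" using g(1)
    by (simp add: x0_def x3_def X0_def add_ac)
  have 3: "x3 * (x0\<^sup>2 + x0 * x3 + x3\<^sup>2) = 3 * lat (q ^ 3) 0 1 2 * Y3" using t
    by (simp add: x0_def x3_def Y3_def lat_001[OF q] power2_eq_square algebra_simps)
  have 4: "X0 * Y3\<^sup>2 = lat (q ^ 3) 0 1 2 * Z" using p(2) unfolding q9
    by (simp add: X0_def Y3_def Z_def power2_eq_square mult.assoc)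
  have 5: "X0 ^ 3 + 2 * Y3 ^ 3 = 3 * lat (q ^ 3) 0 0 0 * Z" using g(2) unfolding q9
    by (simp add: X0_def Y3_def Z_def add_ac)
  note 6 = lat_012[OF q]
  \<comment> \<open>Fact 3 carries, through \<open>lat_001\<close>, the same lattice sum at nome
    \<open>q ^ 3\<close> as fact 4; multiplying fact 3 by 3 Z lets fact 4 remove it.\<close>
  show I: "9 * X0 * Y3 ^ 3 = x3 * (x0\<^sup>2 + x0 * x3 + x3\<^sup>2) * (x0 + 2 * x3)"
    unfolding Z[symmetric] 3 using 4 by (simp add: power2_eq_square power3_eq_cube algebra_simps)
  \<comment> \<open>The factor 6 Z supplies what is needed to replace both lattice sums of
    \<open>lat_012\<close> by theta values, by means of facts 2 and 5.\<close>
  have "6 * Z * x0 * x3\<^sup>2 = 6 * Z * (lat q 0 1 2 * X0)" using 1 by simp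
  also have "\<dots> = 3 * Z * X0 * (3 * lat (q ^ 3) 0 0 0 - lat q 0 0 0)" using 6 by (simp flip: 6)
  also have "\<dots> = 3 * X0 * (X0 ^ 3 + 2 * Y3 ^ 3) - Z * (x0 ^ 3 + 2 * x3 ^ 3)"
    unfolding 2 5 by (simp add: algebra_simps)
  finally have 7: "6 * Z * x0 * x3\<^sup>2 = 3 * X0 * (X0 ^ 3 + 2 * Y3 ^ 3) - Z * (x0 ^ 3 + 2 * x3 ^ 3)" .
  have "9 * X0 ^ 4 = 3 * (3 * X0 * (X0 ^ 3 + 2 * Y3 ^ 3) - Z * (x0 ^ 3 + 2 * x3 ^ 3))
      + (3 * Z) * (x0 ^ 3 + 2 * x3 ^ 3) - 2 * (9 * X0 * Y3 ^ 3)"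
    by (simp add: power4_eq_xxxx power3_eq_cube algebra_simps)
  also have "\<dots> = 6 * (3 * Z) * x0 * x3\<^sup>2 + (3 * Z) * (x0 ^ 3 + 2 * x3 ^ 3) - 2 * (9 * X0 * Y3 ^ 3)"
    unfolding 7[symmetric] by simp
  \<comment> \<open>After extraction of x0 + 2 x3 the cofactor collapses to x0 (x0^2 - 2 x0 x3 + 4
    x3^2), so the product is a sum of two cubes.\<close>
  also have "\<dots> = x0 * (x0 ^ 3 + 8 * x3 ^ 3)"
    unfolding I Z by (simp add: power2_eq_square power3_eq_cube algebra_simps)
  finally show "9 * X0 ^ 4 = x0 * (x0 ^ 3 + 8 * x3 ^ 3)" .
qed

text \<open>The argument counts full turns, so that r/9 stands for a ninth root of unity. Taking the
  real part loses nothing, by \<open>theta_cis_real\<close>.\<close>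

definition rtheta :: "real \<Rightarrow> real \<Rightarrow> real" where "rtheta q x = Re (theta q (cis (2 * pi * x)))"

lemma theta_eq_rtheta: "theta q (cis (2 * pi * x)) = of_real (rtheta q x)"
  unfolding rtheta_def by (rule theta_cis_real)

lemma rtheta_cubic:
  assumes q: "0 < q" "q < 1"
  defines "x0 \<equiv> phi q" and "x3 \<equiv> rtheta q (1/3)" and "X0 \<equiv> phi (q ^ 3)" and "Y3 \<equiv> rtheta (q ^ 3) (1/3)"
  shows "9 * X0 * Y3 ^ 3 = x3 * (x0\<^sup>2 + x0 * x3 + x3\<^sup>2) * (x0 + 2 * x3)"
    and "9 * X0 ^ 4 = x0 * (x0 ^ 3 + 8 * x3 ^ 3)"
    and "3 * phi (q ^ 9) = x0 + 2 * x3"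
proof -
  have q3: "0 < q ^ 3" "q ^ 3 < 1" using q by (auto simp: power_less_one_iff)
  have e: "theta p \<omega> = of_real (rtheta p (1/3))" for p
    using theta_eq_rtheta[of p "1/3"] by (simp add: \<omega>_def)
  note * = theta_cubic_1[OF q] theta_cubic_2[OF q] theta_trisection[OF q]
  from *(1) have "complex_of_real (9 * X0 * Y3 ^ 3) = of_real (x3 * (x0\<^sup>2 + x0 * x3 + x3\<^sup>2) * (x0 + 2 * x3))"
    by (simp add: e theta_1 q q3 assms)
  then show "9 * X0 * Y3 ^ 3 = x3 * (x0\<^sup>2 + x0 * x3 + x3\<^sup>2) * (x0 + 2 * x3)" by (simp only: of_real_eq_iff)
  from *(2) have "complex_of_real (9 * X0 ^ 4) = of_real (x0 * (x0 ^ 3 + 8 * x3 ^ 3))"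
    by (simp add: e theta_1 q q3 assms)
  then show "9 * X0 ^ 4 = x0 * (x0 ^ 3 + 8 * x3 ^ 3)" by (simp only: of_real_eq_iff)
  from *(3) have "complex_of_real (3 * phi (q ^ 9)) = of_real (x0 + 2 * x3)"
    by (simp add: e theta_1 q q3 assms)
  then show "3 * phi (q ^ 9) = x0 + 2 * x3" by (simp only: of_real_eq_iff)
qed

text \<open>Shifts of 1, Z and Z^2 by cube roots of unity run through all ninth roots of unity, and
  evenness leaves five values. The cyclic relations at the three base points share
  \<open>lat q 0 0 1\<close>, the product relations at 1 and Z share \<open>lat q 0 1 2\<close>;
  comparing them eliminates these sums.\<close>

lemma rtheta_ninths:
  assumes q: "0 < q" "q < 1"
  defines "x0 \<equiv> phi q" and "x1 \<equiv> rtheta q (1/9)" and "x2 \<equiv> rtheta q (2/9)"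
    and "x3 \<equiv> rtheta q (1/3)" and "x4 \<equiv> rtheta q (4/9)"
    and "X0 \<equiv> phi (q ^ 3)" and "Y3 \<equiv> rtheta (q ^ 3) (1/3)"
  shows "9 * phi (q ^ 81) = x0 + 2 * (x1 + x2 + x3 + x4)"
    and "x1 * x2 * x4 * X0 = x0 * x3\<^sup>2 * Y3"
    and "x1\<^sup>2 * x4 + x4\<^sup>2 * x2 + x2\<^sup>2 * x1 = x3 * (x0\<^sup>2 + x0 * x3 + x3\<^sup>2)"
    and "(x2\<^sup>2 * x4 + x4\<^sup>2 * x1 + x1\<^sup>2 * x2) * Y3 = x3 * (x0\<^sup>2 + x0 * x3 + x3\<^sup>2) * X0"
proof -
  define Z where "Z = cis (2 * pi / 9)"
  have nZ: "norm Z = 1" "norm (Z\<^sup>2) = 1" by (simp_all add: Z_def norm_power)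
  have q3: "0 < q ^ 3" "q ^ 3 < 1" using q by (auto simp: power_less_one_iff)
  have r: "of_real (rtheta p (real k / 9)) = theta p (Z ^ k)" for p k
    using theta_eq_rtheta[of p "real k / 9"] by (simp add: Z_def Complex.DeMoivre mult_ac)
  have Z9: "Z ^ 9 = 1" by (simp add: Z_def Complex.DeMoivre)
  have sym: "theta p (Z ^ (9 - k)) = theta p (Z ^ k)" if "k \<le> 9" for p k
  proof -
    have "Z ^ (9 - k) * Z ^ k = 1" unfolding power_add[symmetric] using that Z9 by simp
    then have "Z ^ (9 - k) = inverse (Z ^ k)" by (metis inverse_unique mult.commute)
    then show ?thesis by (simp add: theta_inverse)
  qed
  have sym': "theta p (Z ^ 8) = theta p Z" "theta p (Z ^ 7) = theta p (Z\<^sup>2)" 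
    "theta p (Z ^ 6) = theta p (Z ^ 3)" "theta p (Z ^ 5) = theta p (Z ^ 4)" for p
    using sym[of 1 p] sym[of 2 p] sym[of 3 p] sym[of 4 p] by simp_all
  have w: "\<omega> = Z ^ 3" by (simp add: Z_def \<omega>_def Complex.DeMoivre)
  have x: "of_real x0 = theta q 1" "of_real x1 = theta q Z" "of_real x2 = theta q (Z\<^sup>2)"
      "of_real x3 = theta q (Z ^ 3)" "of_real x4 = theta q (Z ^ 4)"
      "of_real X0 = theta (q ^ 3) 1" "of_real Y3 = theta (q ^ 3) (Z ^ 3)"
    using r[of q 1] r[of q 2] r[of q 3] r[of q 4] r[of "q ^ 3" 3]
    by (simp_all add: assms theta_1 q q3)
  have s: "{..<9::nat} = {0, 1, 2, 3, 4, 5, 6, 7, 8}" by auto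
  have c: "cis (2 * pi * real k / 9) = Z ^ k" for k by (simp add: Z_def Complex.DeMoivre mult_ac)
  have "complex_of_real (9 * phi (q ^ 81)) = of_real (x0 + 2 * (x1 + x2 + x3 + x4))"
    using sum_theta_roots_of_unity[OF q, of 9] by (simp add: s c[simplified] c x sym' add_ac)
  then show "9 * phi (q ^ 81) = x0 + 2 * (x1 + x2 + x3 + x4)" by (simp only: of_real_eq_iff)
  have zz: "Z * Z ^ 3 = Z ^ 4" "Z * (Z ^ 3)\<^sup>2 = Z ^ 7" "Z\<^sup>2 * Z ^ 3 = Z ^ 5" "Z\<^sup>2 * (Z ^ 3)\<^sup>2 = Z ^ 8"
    "Z ^ 3 * Z ^ 3 = Z ^ 6" "(Z\<^sup>2) ^ 3 = Z ^ 6" "Z ^ 6 * Z ^ 3 = 1" "Z * Z ^ 6 = Z ^ 7" "Z\<^sup>2 * Z ^ 6 = Z ^ 8" "(Z ^ 3)\<^sup>2 = Z ^ 6"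
    using Z9 by (simp_all flip: power_mult power_add power_Suc)
  have n: "norm (1::complex) = 1" by simp
  note F0 = theta_shift_cyclic[OF q n, unfolded w] and P0 = theta_shift_product[OF q n, unfolded w]
    and F1 = theta_shift_cyclic[OF q nZ(1), unfolded w] and P1 = theta_shift_product[OF q nZ(1), unfolded w]
    and F2 = theta_shift_cyclic[OF q nZ(2), unfolded w]
  note * = F0[simplified zz mult_1_left power_one sym' x[symmetric]] P0[simplified zz mult_1_left power_one sym' x[symmetric]]
     F1[simplified zz mult_1_left power_one sym' x[symmetric]] P1[simplified zz mult_1_left power_one sym' x[symmetric]]
     F2[simplified zz mult_1_left power_one sym' x[symmetric]]
  have F: "complex_of_real (x0\<^sup>2 * x3 + x3\<^sup>2 * x3 + x3\<^sup>2 * x0) = 3 * lat q 0 0 1 * Y3"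
    using *(1) by simp
  have "complex_of_real (x1 * x2 * x4 * X0) = lat q 0 1 2 * Y3 * X0"
    using *(4) by (simp add: mult_ac)
  also have "\<dots> = of_real (x0 * x3\<^sup>2 * Y3)" using *(2) by (simp add: power2_eq_square mult_ac)
  finally show "x1 * x2 * x4 * X0 = x0 * x3\<^sup>2 * Y3" by (simp only: of_real_eq_iff)
  have "complex_of_real (x1\<^sup>2 * x4 + x4\<^sup>2 * x2 + x2\<^sup>2 * x1) = 3 * lat q 0 0 1 * Y3"
    using *(3) by simp
  also have "\<dots> = of_real (x0\<^sup>2 * x3 + x3\<^sup>2 * x3 + x3\<^sup>2 * x0)" using F by simp
  finally have "x1\<^sup>2 * x4 + x4\<^sup>2 * x2 + x2\<^sup>2 * x1 = x0\<^sup>2 * x3 + x3\<^sup>2 * x3 + x3\<^sup>2 * x0"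
    by (simp only: of_real_eq_iff)
  then show "x1\<^sup>2 * x4 + x4\<^sup>2 * x2 + x2\<^sup>2 * x1 = x3 * (x0\<^sup>2 + x0 * x3 + x3\<^sup>2)"
    by (simp add: power2_eq_square algebra_simps)
  have "complex_of_real ((x2\<^sup>2 * x4 + x4\<^sup>2 * x1 + x1\<^sup>2 * x2) * Y3) = 3 * lat q 0 0 1 * X0 * Y3"
    using *(5) by simp
  also have "\<dots> = of_real ((x0\<^sup>2 * x3 + x3\<^sup>2 * x3 + x3\<^sup>2 * x0) * X0)"
    unfolding of_real_mult[of _ X0] F by simp
  finally have "(x2\<^sup>2 * x4 + x4\<^sup>2 * x1 + x1\<^sup>2 * x2) * Y3 = (x0\<^sup>2 * x3 + x3\<^sup>2 * x3 + x3\<^sup>2 * x0) * X0"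
    by (simp only: of_real_eq_iff)
  then show "(x2\<^sup>2 * x4 + x4\<^sup>2 * x1 + x1\<^sup>2 * x2) * Y3 = x3 * (x0\<^sup>2 + x0 * x3 + x3\<^sup>2) * X0"
    by (simp add: power2_eq_square algebra_simps)
qed

subsection \<open>The inversion formula\<close>

text \<open>Orthogonality to all cosines extends to powers of cos (2 pi x), hence to polynomials in
  it. The frequency stays arbitrary in the induction because each product-to-sum step changes it by
  one.\<close>

lemma integral_times_cos_power_eq_0:
  fixes D :: "real \<Rightarrow> real"
  assumes cont: "continuous_on {0..1} D"
    and orth: "\<And>m::nat. integral {0..1} (\<lambda>x. D x * cos (2 * pi * real m * x)) = 0"
  shows "integral {0..1} (\<lambda>x. D x * (cos (2 * pi * x) ^ n * cos (2 * pi * real m * x))) = 0"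
proof (induction n arbitrary: m)
  case 0
  show ?case using orth[of m] by simp
next
  case (Suc n)
  have int: "(\<lambda>x. D x * (cos (2 * pi * x) ^ n * cos (2 * pi * real k * x))) integrable_on {0..1}" for k
    by (intro integrable_continuous_real continuous_intros cont)
  show ?case
  proof (cases m)
    \<comment> \<open>At frequency 0 the lower neighbour m - 1 is not a natural number; instead one
      cosine of the power is read as frequency 1.\<close>
    case 0
    then show ?thesis using Suc.IH[of 1] by (simp add: mult.commute)
  next
    case m: (Suc k)
    have "D x * (cos (2 * pi * x) ^ Suc n * cos (2 * pi * real m * x)) =
       1/2 * (D x * (cos (2 * pi * x) ^ n * cos (2 * pi * real (Suc m) * x))) +
       1/2 * (D x * (cos (2 * pi * x) ^ n * cos (2 * pi * real k * x)))" for x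
    proof -
      have "cos (2 * pi * x) * cos (2 * pi * real m * x) =
          (cos (2 * pi * real m * x - 2 * pi * x) + cos (2 * pi * real m * x + 2 * pi * x)) / 2"
        by (simp add: cos_add cos_diff)
      also have "2 * pi * real m * x - 2 * pi * x = 2 * pi * real k * x" by (simp add: m algebra_simps)
      also have "2 * pi * real m * x + 2 * pi * x = 2 * pi * real (Suc m) * x" by (simp add: algebra_simps)
      finally have 1: "cos (2 * pi * x) * cos (2 * pi * real m * x) =
          (cos (2 * pi * real k * x) + cos (2 * pi * real (Suc m) * x)) / 2" .
      have "D x * (cos (2 * pi * x) ^ Suc n * cos (2 * pi * real m * x)) =
        D x * cos (2 * pi * x) ^ n * (cos (2 * pi * x) * cos (2 * pi * real m * x))"
        by (simp only: power_Suc mult_ac)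
      then show ?thesis unfolding 1 by (simp add: algebra_simps add_divide_distrib)
    qed
    then show ?thesis
      by (simp only: integral_add[OF integrable_on_mult_right[OF int] integrable_on_mult_right[OF int]]
            integral_mult_right Suc.IH mult_zero_right add_0)
  qed
qed

text \<open>The symmetry lets D factor as E (cos (2 pi x)) with E continuous on [-1, 1]. Polynomials
  approximating E are orthogonal to D after this substitution, so the integral of D^2 is arbitrarily
  small.\<close>

lemma cos_series_unique:
  fixes D :: "real \<Rightarrow> real"
  assumes cont: "continuous_on {0..1} D"
    and sym: "\<And>x. x \<in> {0..1} \<Longrightarrow> D (1 - x) = D x"
    and orth: "\<And>m::nat. integral {0..1} (\<lambda>x. D x * cos (2 * pi * real m * x)) = 0"
    and x: "x \<in> {0..1}"
  shows "D x = 0"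
proof -
  have pow: "integral {0..1} (\<lambda>x. D x * cos (2 * pi * x) ^ n) = 0" for n
    using integral_times_cos_power_eq_0[OF cont orth, of n 0] by simp
  define E where "E y = D (arccos y / (2 * pi))" for y
  have "continuous_on {-1..1} E"
    unfolding E_def
  proof (rule continuous_on_compose2[OF cont])
    show "continuous_on {-1..1} (\<lambda>y. arccos y / (2 * pi))"
      by (intro continuous_intros continuous_on_arccos') auto
    show "(\<lambda>y. arccos y / (2 * pi)) ` {- 1..1} \<subseteq> {0..1}"
      using arccos_lbound arccos_ubound pi_gt_zero by (force simp: field_simps)
  qed
  have E: "E (cos (2 * pi * x)) = D x" if "x \<in> {0..1}" for x
  proof (cases "x \<le> 1/2")
    case True
    then have "arccos (cos (2 * pi * x)) = 2 * pi * x" using that by (intro arccos_cos) (auto simp: field_simps)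
    then show ?thesis by (simp add: E_def)
  next
    case False
    have "cos (2 * pi * x) = cos (2 * pi * (1 - x))"
      using cos_2pi_minus[of "2 * pi * x"] by (simp add: algebra_simps)
    moreover have "arccos (cos (2 * pi * (1 - x))) = 2 * pi * (1 - x)"
      using that False by (intro arccos_cos) (auto simp: field_simps)
    ultimately show ?thesis using sym[OF that] by (simp add: E_def)
  qed
  obtain B where B: "\<And>x. x \<in> {0..1} \<Longrightarrow> \<bar>D x\<bar> \<le> B"
    using compact_imp_bounded[OF compact_continuous_image[OF cont compact_Icc]] unfolding bounded_iff
    by (metis image_eqI real_norm_def)
  then have B0: "B \<ge> 0" using x by (meson abs_ge_zero order_trans)
  have sq_int: "(\<lambda>x. D x * D x) integrable_on {0..1}"
    by (intro integrable_continuous_real continuous_intros cont)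
  have le: "integral {0..1} (\<lambda>x. D x * D x) \<le> e * B" if e: "e > 0" for e
  proof -
    obtain p where p: "real_polynomial_function p" "\<And>y. y \<in> {-1..1} \<Longrightarrow> \<bar>E y - p y\<bar> < e"
      using Stone_Weierstrass_real_polynomial_function[OF compact_Icc \<open>continuous_on {-1..1} E\<close> e] by blast
    obtain a n where a: "p = (\<lambda>y. \<Sum>i\<le>n. a i * y ^ i)"
      using p(1) by (auto simp: real_polynomial_function_iff_sum)
    have int: "(\<lambda>x. D x * cos (2 * pi * x) ^ i) integrable_on {0..1}" for i
      by (intro integrable_continuous_real continuous_intros cont)
    have contp: "continuous_on {0..1} (\<lambda>x. p (cos (2 * pi * x)))"
      unfolding a by (intro continuous_intros)
    have "integral {0..1} (\<lambda>x. D x * p (cos (2 * pi * x))) =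
        integral {0..1} (\<lambda>x. \<Sum>i\<le>n. a i * (D x * cos (2 * pi * x) ^ i))"
      unfolding a by (simp add: sum_distrib_left mult_ac)
    also have "\<dots> = (\<Sum>i\<le>n. integral {0..1} (\<lambda>x. a i * (D x * cos (2 * pi * x) ^ i)))"
      by (intro integral_sum integrable_on_mult_right int) auto
    also have "\<dots> = 0" by (simp only: integral_mult_right pow) simp
    finally have 0: "integral {0..1} (\<lambda>x. D x * p (cos (2 * pi * x))) = 0" .
    have "integral {0..1} (\<lambda>x. D x * D x) =
        integral {0..1} (\<lambda>x. D x * D x) - integral {0..1} (\<lambda>x. D x * p (cos (2 * pi * x)))"
      by (simp add: 0)
    also have "\<dots> = integral {0..1} (\<lambda>x. D x * D x - D x * p (cos (2 * pi * x)))"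
      by (intro integral_diff[symmetric] integrable_continuous_real continuous_intros cont contp)
    also have "\<dots> \<le> integral {0..1} (\<lambda>x::real. e * B)"
    proof (rule integral_le)
      fix x :: real assume x: "x \<in> {0..1}"
      have "D x * D x - D x * p (cos (2 * pi * x)) = D x * (E (cos (2 * pi * x)) - p (cos (2 * pi * x)))"
        by (simp only: E[OF x] right_diff_distrib)
      also have "\<dots> \<le> \<bar>D x\<bar> * \<bar>E (cos (2 * pi * x)) - p (cos (2 * pi * x))\<bar>"
        by (metis abs_ge_self abs_mult)
      also have "\<dots> \<le> B * e"
        using B[OF x] B0 p(2)[of "cos (2 * pi * x)"] by (intro mult_mono) auto
      finally show "D x * D x - D x * p (cos (2 * pi * x)) \<le> e * B" by (simp add: mult.commute)
    qed (intro integrable_continuous_real continuous_intros cont contp)+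
    finally show ?thesis by simp
  qed
  have "integral {0..1} (\<lambda>x. D x * D x) \<le> 0"
  proof (rule field_le_epsilon)
    fix e :: real assume "e > 0"
    \<comment> \<open>Dividing by B + 1 instead of B covers the case B = 0.\<close>
    then have "integral {0..1} (\<lambda>x. D x * D x) \<le> e / (B + 1) * B" using B0 by (intro le) auto
    also have "\<dots> \<le> e" using B0 \<open>e > 0\<close> by (simp add: field_simps)
    finally show "integral {0..1} (\<lambda>x. D x * D x) \<le> 0 + e" by simp
  qed
  moreover have "integral {0..1} (\<lambda>x. D x * D x) \<ge> 0"
    by (intro integral_nonneg sq_int) auto
  ultimately have "integral {0..1} (\<lambda>x. D x * D x) = 0" by simp
  then have "\<forall>x\<in>{0..1}. D x * D x = 0"
    by (subst (asm) integral_eq_0_iff) (auto intro!: continuous_intros cont)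
  with x show ?thesis by auto
qed

text \<open>This is the characteristic function exp (-r^2/2) of the standard normal law under y = c
  x: c is chosen with y^2/2 = pi t x^2, and r with r c = 2 pi s.\<close>

lemma gaussian_fourier:
  fixes t s :: real
  assumes "t > 0"
  shows "has_bochner_integral lborel (\<lambda>x. exp (- pi * t * x\<^sup>2) * cos (2 * pi * s * x)) (exp (- pi * s\<^sup>2 / t) / sqrt t)"
proof -
  define c where "c = sqrt (2 * pi * t)"
  have c: "c > 0" "c\<^sup>2 = 2 * pi * t" using assms by (simp_all add: c_def)
  define r where "r = 2 * pi * s / c"
  have int: "integrable lborel (\<lambda>y. std_normal_density y *\<^sub>R iexp (r * y))"
    by (rule Bochner_Integration.integrable_bound[OF integrable_normal_density[of 1 0]]) auto
  have "(LINT y|lborel. std_normal_density y *\<^sub>R iexp (r * y)) = char std_normal_distribution r"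
    unfolding char_def by (subst integral_density) auto
  also have "\<dots> = of_real (exp (- (r\<^sup>2) / 2))" by (simp add: char_std_normal_distribution)
  finally have "has_bochner_integral lborel (\<lambda>y. std_normal_density y *\<^sub>R iexp (r * y)) (of_real (exp (- (r\<^sup>2) / 2)))"
    using int by (simp add: has_bochner_integral_iff)
  from has_bochner_integral_Re[OF this]
  have "has_bochner_integral lborel (\<lambda>y. std_normal_density y * cos (r * y)) (exp (- (r\<^sup>2) / 2))"
    by (simp add: Re_exp)
  also have "?this \<longleftrightarrow> has_bochner_integral lborel (\<lambda>x. std_normal_density (0 + c * x) * cos (r * (0 + c * x)))
      (exp (- (r\<^sup>2) / 2) /\<^sub>R \<bar>c\<bar>)"
    using c(1) by (intro lborel_has_bochner_integral_real_affine_iff) auto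
  finally have "has_bochner_integral lborel (\<lambda>x. sqrt (2 * pi) * (std_normal_density (0 + c * x) * cos (r * (0 + c * x))))
     (sqrt (2 * pi) * (exp (- (r\<^sup>2) / 2) /\<^sub>R \<bar>c\<bar>))"
    by (rule has_bochner_integral_mult_right)
  moreover have "sqrt (2 * pi) * (std_normal_density (0 + c * x) * cos (r * (0 + c * x))) =
      exp (- pi * t * x\<^sup>2) * cos (2 * pi * s * x)" for x
    using c(1) by (simp add: std_normal_density_def power_mult_distrib c(2) r_def mult.assoc)
  moreover have "sqrt (2 * pi) * (exp (- (r\<^sup>2) / 2) /\<^sub>R \<bar>c\<bar>) = exp (- pi * s\<^sup>2 / t) / sqrt t"
  proof -
    have "r\<^sup>2 / 2 = pi * s\<^sup>2 / t"
      using assms by (simp add: r_def power_divide power_mult_distrib c(2)) (simp add: power2_eq_square field_simps)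
    then show ?thesis using assms c(1) by (simp add: c_def real_sqrt_mult field_simps)
  qed
  ultimately show ?thesis by simp
qed

section \<open>Exhaustion of the line, two-sided series and termwise Fourier coefficients\<close>

lemma integral_symmetric_tendsto:
  fixes f :: "real \<Rightarrow> real"
  assumes "has_bochner_integral lborel f I"
  shows "(\<lambda>N. integral {- real N..real N} f) \<longlonglongrightarrow> I"
proof -
  have int: "integrable lborel f" and I: "I = (LINT x|lborel. f x)"
    using assms by (auto simp: has_bochner_integral_iff)
  have si: "set_integrable lborel {- real N..real N} f" for N
    unfolding set_integrable_def using int by (intro integrable_mult_indicator) auto
  have "(\<lambda>N. LINT x|lborel. indicator {- real N..real N} x *\<^sub>R f x) \<longlonglongrightarrow> (LINT x|lborel. f x)"
  proof (rule integral_dominated_convergence[where w = "\<lambda>x. norm (f x)"])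
    show "AE x in lborel. (\<lambda>N. indicator {- real N..real N} x *\<^sub>R f x) \<longlonglongrightarrow> f x"
    proof (rule AE_I2)
      fix x :: real
      obtain M :: nat where M: "\<bar>x\<bar> \<le> real M" using real_arch_simple by blast
      show "(\<lambda>N. indicator {- real N..real N} x *\<^sub>R f x) \<longlonglongrightarrow> f x"
      proof (rule tendsto_eventually, rule eventually_sequentiallyI[of M])
        fix N assume "M \<le> N"
        then have "\<bar>x\<bar> \<le> real N" using M by linarith
        then show "indicator {- real N..real N} x *\<^sub>R f x = f x" by (auto simp: indicator_def)
      qed
    qed
  qed (use int in \<open>auto simp: indicator_def\<close>)
  also have "(\<lambda>N. LINT x|lborel. indicator {- real N..real N} x *\<^sub>R f x) = (\<lambda>N. integral {- real N..real N} f)"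
    using set_borel_integral_eq_integral(2)[OF si] by (simp add: set_lebesgue_integral_def)
  finally show ?thesis unfolding I .
qed

text \<open>Pairing j with -1-j counts 0 once and lists the integers in blocks from -N to N-1, which
  fit the unit intervals tiling [-N, N].\<close>

lemma has_sum_int_imp_sums:
  fixes f :: "int \<Rightarrow> 'a :: banach"
  assumes "(f has_sum S) UNIV"
  shows "(\<lambda>j. f (int j) + f (- 1 - int j)) sums S"
proof -
  have "f summable_on UNIV" using assms by (rule has_sum_imp_summable)
  then have "f summable_on range int" "f summable_on range (\<lambda>j. - 1 - int j)"
    by (auto intro: summable_on_subset_banach)
  then obtain S1 S2 where S: "(f has_sum S1) (range int)" "(f has_sum S2) (range (\<lambda>j. - 1 - int j))"
    by (auto simp: summable_on_def)
  have "range int \<inter> range (\<lambda>j. - 1 - int j) = {}" by auto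
  from has_sum_Un_disjoint[OF S this] have "(f has_sum (S1 + S2)) UNIV"
    by (simp add: range_int_Un_negative)
  then have "S = S1 + S2" using assms has_sum_unique by blast
  moreover have "((\<lambda>j. f (int j)) has_sum S1) UNIV" "((\<lambda>j. f (- 1 - int j)) has_sum S2) UNIV"
    using S by (auto simp: has_sum_reindex inj_on_def o_def)
  ultimately show ?thesis
    by (metis sums_add has_sum_imp_sums)
qed

lemma summable_gaussian:
  fixes a :: real
  assumes "a > 0"
  shows "summable (\<lambda>j::nat. exp (- a * (real j)\<^sup>2))"
proof (rule summable_comparison_test')
  show "summable (\<lambda>j. exp (- a) ^ j)" using assms by (intro summable_geometric) simp
  fix j :: nat
  have "real j \<le> (real j)\<^sup>2" by (cases j) (auto simp: power2_eq_square)
  then have "a * real j \<le> a * (real j)\<^sup>2" using assms by simp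
  then show "norm (exp (- a * (real j)\<^sup>2)) \<le> exp (- a) ^ j"
    by (simp flip: exp_of_nat_mult add: mult.commute)
qed

text \<open>A cosine factor does not spoil the majorant, so uniform convergence permits computing
  Fourier coefficients term by term.\<close>

lemma
  fixes f :: "nat \<Rightarrow> real \<Rightarrow> real"
  assumes cont: "\<And>n. continuous_on {0..1} (f n)" and bound: "\<And>n x. x \<in> {0..1} \<Longrightarrow> \<bar>f n x\<bar> \<le> M n"
    and M: "summable M"
  shows continuous_on_suminf_M_test: "continuous_on {0..1} (\<lambda>x. \<Sum>n. f n x)"
    and integral_suminf_cos_tendsto: "(\<lambda>N. \<Sum>j<N. integral {0..1} (\<lambda>x. f j x * cos (w * x))) \<longlonglongrightarrow>
           integral {0..1} (\<lambda>x. (\<Sum>n. f n x) * cos (w * x))"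
proof -
  have "uniform_limit {0..1} (\<lambda>N x. \<Sum>j<N. f j x) (\<lambda>x. \<Sum>n. f n x) sequentially"
    using bound M by (intro Weierstrass_m_test) auto
  then show "continuous_on {0..1} (\<lambda>x. \<Sum>n. f n x)"
    by (rule uniform_limit_theorem[rotated]) (auto intro!: always_eventually continuous_intros cont)
  have sm: "summable (\<lambda>n. f n x)" if "x \<in> {0..1}" for x
    using bound[OF that] by (intro summable_comparison_test'[OF M]) auto
  have fb: "norm (f n x * cos (w * x)) \<le> M n" if "x \<in> {0..1}" for n x
  proof -
    have "\<bar>f n x\<bar> * \<bar>cos (w * x)\<bar> \<le> M n * 1"
      by (rule mult_mono) (use bound[OF that, of n] abs_ge_zero[of "f n x"] in auto)
    then show ?thesis by (simp add: abs_mult)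
  qed
  have ci: "continuous_on {0..1} (\<lambda>x. f j x * cos (w * x))" for j
    by (intro continuous_intros cont)
  have "uniform_limit {0..1} (\<lambda>N x. \<Sum>j<N. f j x * cos (w * x)) (\<lambda>x. \<Sum>n. f n x * cos (w * x)) sequentially"
    by (rule Weierstrass_m_test[OF fb M])
  then obtain I J where IJ: "\<And>N. ((\<lambda>x. \<Sum>j<N. f j x * cos (w * x)) has_integral I N) {0..1}"
      "((\<lambda>x. \<Sum>n. f n x * cos (w * x)) has_integral J) {0..1}" "I \<longlonglongrightarrow> J"
    by (rule uniform_limit_integral) (auto intro!: continuous_intros cont)
  have "I N = (\<Sum>j<N. integral {0..1} (\<lambda>x. f j x * cos (w * x)))" for N
    using integral_unique[OF IJ(1)] by (subst integral_sum[symmetric]) (auto intro!: integrable_continuous_real ci)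
  moreover have "J = integral {0..1} (\<lambda>x. (\<Sum>n. f n x) * cos (w * x))"
    unfolding integral_unique[OF IJ(2), symmetric]
    by (intro integral_cong suminf_mult2[symmetric] sm)
  ultimately show "(\<lambda>N. \<Sum>j<N. integral {0..1} (\<lambda>x. f j x * cos (w * x))) \<longlonglongrightarrow>
           integral {0..1} (\<lambda>x. (\<Sum>n. f n x) * cos (w * x))"
    using IJ(3) by presburger
qed

lemma integral_cos_int:
  "integral {0..1} (\<lambda>x. cos (2 * pi * of_int k * x)) = (if k = 0 then 1 else 0 :: real)"
proof (cases "k = 0")
  case False
  have "((\<lambda>x. cos (2 * pi * of_int k * x)) has_integral
      (sin (2 * pi * of_int k * 1) / (2 * pi * of_int k) - sin (2 * pi * of_int k * 0) / (2 * pi * of_int k))) {0..1::real}"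
    by (rule fundamental_theorem_of_calculus)
      (use False in \<open>auto intro!: derivative_eq_intros simp flip: has_real_derivative_iff_has_vector_derivative\<close>)
  then show ?thesis using False sin_int_2pin[of k] by (simp add: integral_unique)
qed simp

lemma integral_cos_cos:
  fixes j m :: nat
  shows "integral {0..1} (\<lambda>x. cos (2 * pi * real j * x) * cos (2 * pi * real m * x)) =
    (if j = m then if m = 0 then 1 else 1 / 2 else 0 :: real)"
proof -
  have "cos (2 * pi * real j * x) * cos (2 * pi * real m * x) =
      1/2 * cos (2 * pi * of_int (int j - int m) * x) + 1/2 * cos (2 * pi * of_int (int j + int m) * x)" for x
  proof -
    have 1: "2 * pi * of_int (int j - int m) * x = 2 * pi * real j * x - 2 * pi * real m * x"
      "2 * pi * of_int (int j + int m) * x = 2 * pi * real j * x + 2 * pi * real m * x"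
      by (simp_all add: algebra_simps)
    show ?thesis unfolding 1 cos_add cos_diff by (simp add: field_simps)
  qed
  moreover have int: "(\<lambda>x. 1/2 * cos (2 * pi * of_int k * x)) integrable_on {0..1::real}" for k
    by (intro integrable_continuous_real continuous_intros)
  ultimately show ?thesis
    by (simp only: integral_add[OF int int] integral_mult_right integral_cos_int) auto
qed

text \<open>Poisson summation for a Gaussian: its periodisation H and the series S built from its
  Fourier transform have the same cosine coefficients, so they agree at 0, where they are the two
  theta values up to the factor sqrt t.\<close>

theorem phi_inversion:
  fixes t :: real
  assumes t: "t > 0"
  shows "phi (exp (- pi / t)) = sqrt t * phi (exp (- pi * t))"
proof -
  define g where "g x = exp (- pi * t * x\<^sup>2)" for x
  define h where "h j x = g (x + real j) + g (x + (- 1 - real j))" for j :: nat and x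
  define c where "c j = exp (- pi * (real j)\<^sup>2 / t) / sqrt t" for j
  \<comment> \<open>Pairing j with Suc j lists frequency 0 once and every positive frequency twice,
    as a two-sided series does.\<close>
  define s where "s j x = c j * cos (2 * pi * real j * x) + c (Suc j) * cos (2 * pi * real (Suc j) * x)" for j x
  have gc: "continuous_on A g" for A unfolding g_def by (intro continuous_intros)
  have hc: "continuous_on {0..1} (h j)" for j
    unfolding h_def by (intro continuous_intros continuous_on_compose2[OF gc]) auto
  have sc: "continuous_on {0..1} (s j)" for j
    unfolding s_def by (intro continuous_intros)
  have c0: "c j \<ge> 0" for j using t by (simp add: c_def)
  have cs: "summable c"
    using summable_divide[OF summable_gaussian[of "pi / t"], of "sqrt t"] t by (simp add: c_def[abs_def])
  have hb: "\<bar>h j x\<bar> \<le> 2 * exp (- (pi * t) * (real j)\<^sup>2)" if "x \<in> {0..1}" for j x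
  proof -
    have "(real j)\<^sup>2 \<le> (x + real j)\<^sup>2" using that by (intro power_mono) auto
    moreover have "(real j)\<^sup>2 \<le> (1 + real j - x)\<^sup>2" using that by (intro power_mono) auto
    then have "(real j)\<^sup>2 \<le> (x + (- 1 - real j))\<^sup>2" by (simp add: power2_eq_square algebra_simps)
    ultimately have "g (x + real j) \<le> exp (- (pi * t) * (real j)\<^sup>2)"
      "g (x + (- 1 - real j)) \<le> exp (- (pi * t) * (real j)\<^sup>2)" using t by (simp_all add: g_def)
    moreover have "g y \<ge> 0" for y by (simp add: g_def)
    ultimately show ?thesis by (simp add: h_def abs_of_nonneg)
  qed
  have hs: "summable (\<lambda>j. 2 * exp (- (pi * t) * (real j)\<^sup>2))"
    using t by (intro summable_mult summable_gaussian) simp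
  have sb: "\<bar>s j x\<bar> \<le> c j + c (Suc j)" for j x
  proof -
    have *: "\<bar>c j * cos y\<bar> \<le> c j" for j y
      using c0[of j] abs_cos_le_one[of y] by (simp add: abs_mult mult_left_le)
    have "\<bar>s j x\<bar> \<le> \<bar>c j * cos (2 * pi * real j * x)\<bar> + \<bar>c (Suc j) * cos (2 * pi * real (Suc j) * x)\<bar>"
      unfolding s_def by (rule abs_triangle_ineq)
    also have "\<dots> \<le> c j + c (Suc j)" by (intro add_mono *)
    finally show ?thesis .
  qed
  have ss: "summable (\<lambda>j. c j + c (Suc j))"
    using cs by (intro summable_add) (auto simp: summable_Suc_iff)
  define H where "H x = (\<Sum>j. h j x)" for x
  define S where "S x = (\<Sum>j. s j x)" for x
  have Hc: "continuous_on {0..1} H" and Sc: "continuous_on {0..1} S"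
    unfolding H_def S_def using continuous_on_suminf_M_test[OF hc hb hs] continuous_on_suminf_M_test[OF sc sb ss] by auto
  have Hm: "integral {0..1} (\<lambda>x. H x * cos (2 * pi * real m * x)) = c m" for m
  proof -
    define G where "G x = g x * cos (2 * pi * real m * x)" for x
    have Gc: "continuous_on A G" for A unfolding G_def by (intro continuous_intros gc)
    have Gi: "G integrable_on {a..b}" for a b by (intro integrable_continuous_real Gc)
    have "integral {0..1} (\<lambda>x. h j x * cos (2 * pi * real m * x)) =
        integral {real j..real (Suc j)} G + integral {- real (Suc j)..- real j} G" for j
    proof -
      have cp: "cos (2 * pi * real m * (x + real_of_int n)) = cos (2 * pi * real m * x)" for x n
      proof -
        have "2 * pi * real m * (x + real_of_int n) = 2 * pi * real m * x + 2 * pi * of_int (int m * n)"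
          by (simp add: algebra_simps)
        then show ?thesis
          by (simp only: cos_add cos_int_2pin sin_int_2pin mult_1_right mult_zero_right diff_zero)
      qed
      have "h j x * cos (2 * pi * real m * x) = G (x + real j) + G (x + (- 1 - real j))" for x
        using cp[of x "int j"] cp[of x "- 1 - int j"] by (simp add: h_def G_def algebra_simps)
      moreover have "(\<lambda>x. G (x + a)) integrable_on {0..1}" for a
        by (intro integrable_continuous_real continuous_on_compose2[OF Gc[of UNIV]] continuous_intros) auto
      ultimately have "integral {0..1} (\<lambda>x. h j x * cos (2 * pi * real m * x)) =
          integral {0..1} (\<lambda>x. G (x + real j)) + integral {0..1} (\<lambda>x. G (x + (- 1 - real j)))"
        by (simp add: integral_add)
      also have "integral {0..1} (\<lambda>x. G (x + real j)) = integral {real j..real (Suc j)} G"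
        using integral_shift_real_ivl[of "real j" "real j" "real (Suc j)" G] by simp
      also have "integral {0..1} (\<lambda>x. G (x + (- 1 - real j))) = integral {- real (Suc j)..- real j} G"
        using integral_shift_real_ivl[of "- real (Suc j)" "- 1 - real j" "- real j" G] by simp
      finally show ?thesis .
    qed
    \<comment> \<open>The pieces [j, j+1] and [-j-1, -j] for j < N fill [-N, N], so the limit is the
      full Gaussian transform.\<close>
    then have "(\<Sum>j<N. integral {0..1} (\<lambda>x. h j x * cos (2 * pi * real m * x))) = integral {- real N..real N} G" for N
    proof (induction N)
      case (Suc N)
      have "integral {- real (Suc N)..real (Suc N)} G =
          integral {- real (Suc N)..- real N} G + integral {- real N..real (Suc N)} G"
        by (rule Henstock_Kurzweil_Integration.integral_combine[symmetric]) (auto intro: Gi)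
      also have "integral {- real N..real (Suc N)} G = integral {- real N..real N} G + integral {real N..real (Suc N)} G"
        by (rule Henstock_Kurzweil_Integration.integral_combine[symmetric]) (auto intro: Gi)
      finally show ?case using Suc by simp
    qed simp
    moreover have "(\<lambda>N. integral {- real N..real N} G) \<longlonglongrightarrow> c m"
      using integral_symmetric_tendsto[OF gaussian_fourier[OF t, of "real m"]]
      unfolding G_def[abs_def] g_def c_def .
    ultimately show ?thesis
      using integral_suminf_cos_tendsto[OF hc hb hs, of "2 * pi * real m"] unfolding H_def[symmetric]
      by (metis (no_types, lifting) LIMSEQ_unique ext)
  qed
  have Sm: "integral {0..1} (\<lambda>x. S x * cos (2 * pi * real m * x)) = c m" for m
  proof -
    define d where "d j = (if j = m then if m = 0 then 1 else 1 / 2 else 0 :: real)" for j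
    have int: "(\<lambda>x. a * (cos (2 * pi * real j * x) * cos (2 * pi * real m * x))) integrable_on {0..1}" for a j
      by (intro integrable_continuous_real continuous_intros)
    have "s j x * cos (2 * pi * real m * x) = c j * (cos (2 * pi * real j * x) * cos (2 * pi * real m * x)) +
        c (Suc j) * (cos (2 * pi * real (Suc j) * x) * cos (2 * pi * real m * x))" for j x
      by (simp only: s_def distrib_right mult.assoc)
    then have sj: "integral {0..1} (\<lambda>x. s j x * cos (2 * pi * real m * x)) = c j * d j + c (Suc j) * d (Suc j)" for j
      by (simp only: integral_add[OF int int] integral_mult_right integral_cos_cos d_def)
    have "(\<Sum>j<N. integral {0..1} (\<lambda>x. s j x * cos (2 * pi * real m * x))) = c m" if "N > m" for N
    proof -
      have d1: "(\<Sum>j<N. c j * d j) = c m * d m"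
        using that by (subst sum.mono_neutral_right[of _ "{m}"]) (auto simp: d_def)
      \<comment> \<open>A positive frequency occurs in both halves of the pairing and contributes
        1/2 twice; frequency 0 occurs in the first half only and contributes 1.\<close>
      have d2: "(\<Sum>j<N. c (Suc j) * d (Suc j)) = (if m = 0 then 0 else c m * d m)"
      proof (cases m)
        case 0
        then show ?thesis by (auto simp: d_def)
      next
        case (Suc k)
        then show ?thesis
          using that by (subst sum.mono_neutral_right[of _ "{k}"]) (auto simp: d_def)
      qed
      show ?thesis unfolding sj sum.distrib d1 d2 by (simp add: d_def)
    qed
    then have "(\<lambda>N. \<Sum>j<N. integral {0..1} (\<lambda>x. s j x * cos (2 * pi * real m * x))) \<longlonglongrightarrow> c m"
      by (intro tendsto_eventually eventually_sequentiallyI[of "Suc m"]) auto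
    then show ?thesis
      using integral_suminf_cos_tendsto[OF sc sb ss, of "2 * pi * real m"] unfolding S_def[symmetric]
      by (metis (no_types, lifting) LIMSEQ_unique)
  qed
  have "H 0 - S 0 = 0"
  proof (rule cos_series_unique[of "\<lambda>x. H x - S x"])
    show "continuous_on {0..1} (\<lambda>x. H x - S x)" by (intro continuous_intros Hc Sc)
    fix x :: real
    have ge: "g (- y) = g y" for y by (simp add: g_def)
    have "h j (1 - x) = h j x" for j
      using ge[of "x + real j"] ge[of "x + (- 1 - real j)"] by (simp add: h_def algebra_simps)
    moreover have "s j (1 - x) = s j x" for j
    proof -
      have "cos (2 * pi * real k * (1 - x)) = cos (2 * pi * real k * x)" for k
      proof -
        have "2 * pi * real k * (1 - x) = 2 * pi * of_int (int k) - 2 * pi * real k * x" by (simp add: algebra_simps)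
        then show ?thesis by (simp only: cos_diff cos_int_2pin sin_int_2pin mult_1_left mult_zero_left add_0_right)
      qed
      then show ?thesis by (simp only: s_def)
    qed
    ultimately show "H (1 - x) - S (1 - x) = H x - S x" by (simp add: H_def S_def)
  next
    fix m :: nat
    have "(\<lambda>x. H x * cos (2 * pi * real m * x)) integrable_on {0..1}"
      "(\<lambda>x. S x * cos (2 * pi * real m * x)) integrable_on {0..1}"
      by (intro integrable_continuous_real continuous_intros Hc Sc)+
    then show "integral {0..1} (\<lambda>x. (H x - S x) * cos (2 * pi * real m * x)) = 0"
      by (simp add: left_diff_distrib integral_diff Hm Sm)
  qed simp
  moreover have "H 0 = phi (exp (- pi * t))"
  proof -
    have "(\<lambda>j. exp (- pi * t) powi (int j)\<^sup>2 + exp (- pi * t) powi (- 1 - int j)\<^sup>2) sums phi (exp (- pi * t))"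
      using t by (intro has_sum_int_imp_sums phi_has_sum) auto
    moreover have "exp (- pi * t) powi (int j)\<^sup>2 + exp (- pi * t) powi (- 1 - int j)\<^sup>2 = h j 0" for j
      by (simp add: exp_power_int h_def g_def mult_ac)
    ultimately show ?thesis unfolding H_def by (simp add: sums_iff)
  qed
  moreover have "S 0 = phi (exp (- pi / t)) / sqrt t"
  proof -
    have "(\<lambda>j. (exp (- pi / t) powi (int j)\<^sup>2 + exp (- pi / t) powi (- 1 - int j)\<^sup>2) / sqrt t) sums (phi (exp (- pi / t)) / sqrt t)"
      using t by (intro sums_divide has_sum_int_imp_sums phi_has_sum) auto
    moreover have "(exp (- pi / t) powi (int j)\<^sup>2 + exp (- pi / t) powi (- 1 - int j)\<^sup>2) / sqrt t = s j 0" for j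
    proof -
      have "(- 1 - int j)\<^sup>2 = (int (Suc j))\<^sup>2" by (simp add: power2_eq_square algebra_simps)
      then show ?thesis by (simp add: exp_power_int s_def c_def mult_ac add_divide_distrib)
    qed
    ultimately show ?thesis unfolding S_def by (simp add: sums_iff)
  qed
  ultimately show ?thesis using t by (simp add: field_simps)
qed

subsection \<open>Identities in the number field\<close>

text \<open>Rewrite rules for reducing powers of a cube root; the version with a trailing factor z
  matches inside right-nested products.\<close>

lemma cube_reduce:
  fixes A :: "'a :: comm_ring_1"
  assumes "A ^ 3 = k"
  shows "A * (A * A) = k" "A * (A * (A * z)) = k * z"
  using assms by (auto simp: power3_eq_cube mult.assoc[symmetric])

text \<open>Here u denests the cube root u3 inside Q(2^(1/3), 3^(1/3)), so each claim can be checked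
  on the basis A^i B^j. The middle three match the symmetric functions of \<alpha>, \<beta>,
  \<gamma> with the expressions in \<open>rtheta_ninths_symmetric\<close>; the last evaluates
  p^3.\<close>

lemma cubic_field_identities:
  fixes A B a b c u :: real
  assumes A: "A ^ 3 = 2" and B: "B ^ 3 = 3"
    and a: "a = 4 * A * B ^ 2 * (1 + A) + 2 * B * (A + A ^ 2) ^ 2 + 6 * (1 + A + A ^ 2)"
    and b: "b = 4 * (1 + B * (B + 1) - 2 * A * (B + A - 1))"
    and c: "c = 4 * (1 - A * (B - 1) * (B + A - 1))"
    and u: "u = (A + A ^ 2) * B ^ 2 / 3"
  shows "u ^ 3 = 2 * (1 + A + A ^ 2)"
    and "a = 3 * (u * (4 + 2 * u + u ^ 2))"
    and "a ^ 2 / 27 - (b ^ 2 + b * c + c ^ 2) / 108 = 2 * u ^ 3 * (4 + 2 * u + u ^ 2)"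
    and "(a ^ 3 - 3 / 4 * a * (b ^ 2 + b * c + c ^ 2) + (c ^ 3 - b ^ 3) / 8 - 3 / 4 * b ^ 2 * c - 3 / 8 * b * c ^ 2) / 729
           * (1 - u + u ^ 2) = u ^ 7 * (4 + 2 * u + u ^ 2)"
    and "8 * (A + A ^ 2 + B) ^ 3 * (A - 1) * (1 - u + u ^ 2) = u ^ 7 * (4 + 2 * u + u ^ 2) * (9 - 2 * B ^ 4)"
proof -
  note r = cube_reduce[OF A] cube_reduce[OF B] power2_eq_square algebra_simps
  note r2 = cube_reduce[OF A] cube_reduce[OF B] power2_eq_square field_simps
  have B4: "B ^ 4 = 3 * B" using B by (simp add: power_numeral_reduce)
  have u2: "u ^ 2 = (4 + 2 * A + A ^ 2) * B / 3" unfolding u by (simp add: r2)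
  have u3: "u ^ 3 = 2 * (1 + A + A ^ 2)"
  proof -
    have "u ^ 3 = u * u ^ 2" by (simp add: power3_eq_cube power2_eq_square)
    then show ?thesis unfolding u2 unfolding u by (simp add: r2)
  qed
  then show "u ^ 3 = 2 * (1 + A + A ^ 2)" .
  have u7: "u ^ 7 = (56 + 44 * A + 36 * A ^ 2) * B ^ 2 / 3"
  proof -
    have "u ^ 7 = u ^ 3 * u ^ 3 * u" by (simp add: power_numeral_reduce)
    then show ?thesis unfolding u3 unfolding u by (simp add: r2)
  qed
  have v: "4 + 2 * u + u ^ 2 = 4 + (4 + 2 * A + A ^ 2) * B / 3 + 2 * (A + A ^ 2) * B ^ 2 / 3"
    unfolding u2 unfolding u by simp
  have w: "1 - u + u ^ 2 = 1 + (4 + 2 * A + A ^ 2) * B / 3 - (A + A ^ 2) * B ^ 2 / 3"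
    unfolding u2 unfolding u by simp
  have e1: "u * (4 + 2 * u + u ^ 2) = 4 * u + 2 * u ^ 2 + u ^ 3"
    by (simp add: power3_eq_cube power2_eq_square algebra_simps)
  have a': "a = 6 + 6 * A + 6 * A ^ 2 + (8 + 4 * A + 2 * A ^ 2) * B + 4 * (A + A ^ 2) * B ^ 2"
    unfolding a by (simp add: r)
  show "a = 3 * (u * (4 + 2 * u + u ^ 2))" unfolding e1 u2 u3 a' unfolding u by (simp add: r2)
  have b': "b = 4 + 4 * B + 4 * B ^ 2 + 8 * A - 8 * A * B - 8 * A ^ 2" unfolding b by (simp add: r)
  have c': "c = 4 - 4 * A + 8 * A * B - 4 * A * B ^ 2 + 4 * A ^ 2 - 4 * A ^ 2 * B" unfolding c by (simp add: r)
  have b2: "b ^ 2 = - 144 + 336 * B + 48 * B ^ 2 - 192 * A ^ 2 * B" unfolding b' by (simp add: r)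
  have bc: "b * c = 144 - 240 * B + 144 * B ^ 2 + 96 * A ^ 2 * B - 96 * A ^ 2 * B ^ 2"
    unfolding b' c' by (simp add: r)
  have c2: "c ^ 2 = 144 + 192 * B - 192 * B ^ 2 - 144 * A ^ 2 - 48 * A ^ 2 * B + 96 * A ^ 2 * B ^ 2"
    unfolding c' by (simp add: r)
  have K: "b ^ 2 + b * c + c ^ 2 = 144 + 288 * B - 144 * A ^ 2 - 144 * A ^ 2 * B"
    unfolding b2 bc c2 by simp
  have a2: "a ^ 2 = 468 + 432 * B + 288 * B ^ 2 + 432 * A + 288 * A * B + 216 * A * B ^ 2 + 396 * A ^ 2
      + 216 * A ^ 2 * B + 144 * A ^ 2 * B ^ 2" unfolding a' by (simp add: r)
  show "a ^ 2 / 27 - (b ^ 2 + b * c + c ^ 2) / 108 = 2 * u ^ 3 * (4 + 2 * u + u ^ 2)"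
    unfolding a2 K u3 v by (simp add: r2)
  have a3: "a ^ 3 = 37800 + 25920 * B + 19008 * B ^ 2 + 30888 * A + 20736 * A * B + 14688 * A * B ^ 2
      + 24192 * A ^ 2 + 17496 * A ^ 2 * B + 11232 * A ^ 2 * B ^ 2"
  proof -
    have "a ^ 3 = a * a ^ 2" by (simp add: power3_eq_cube power2_eq_square)
    then show ?thesis unfolding a2 unfolding a' by (simp add: r)
  qed
  have aK: "a * (b ^ 2 + b * c + c ^ 2) = - 4320 - 864 * A + 3456 * A ^ 2"
    unfolding K a' by (simp add: r)
  have b3: "b ^ 3 = 4032 - 1728 * B + 4032 * B ^ 2 - 2304 * A + 6912 * A * B - 2304 * A * B ^ 2
      - 1152 * A ^ 2 - 3456 * A ^ 2 * B - 1152 * A ^ 2 * B ^ 2"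
  proof -
    have "b ^ 3 = b * b ^ 2" by (simp add: power3_eq_cube power2_eq_square)
    then show ?thesis unfolding b2 unfolding b' by (simp add: r)
  qed
  have c3: "c ^ 3 = 7488 - 3456 * B - 1152 * B ^ 2 - 10944 * A + 3456 * A * B + 2880 * A * B ^ 2
      + 2304 * A ^ 2 - 1152 * A ^ 2 * B ^ 2"
  proof -
    have "c ^ 3 = c * c ^ 2" by (simp add: power3_eq_cube power2_eq_square)
    then show ?thesis unfolding c2 unfolding c' by (simp add: r)
  qed
  have b2c: "b ^ 2 * c = 4032 + 2880 * B - 2880 * B ^ 2 - 2304 * A - 4608 * A * B + 4608 * A * B ^ 2
      - 1152 * A ^ 2 + 1152 * A ^ 2 * B - 1152 * A ^ 2 * B ^ 2"
    unfolding b2 unfolding c' by (simp add: r)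
  have bc2: "b * c ^ 2 = - 6336 + 576 * B + 2880 * B ^ 2 + 8064 * A + 1152 * A * B - 4608 * A * B ^ 2
      - 1152 * A ^ 2 - 1152 * A ^ 2 * B + 1152 * A ^ 2 * B ^ 2"
    unfolding c2 unfolding b' by (simp add: r)
  have "(a ^ 3 - 3 / 4 * a * (b ^ 2 + b * c + c ^ 2) + (c ^ 3 - b ^ 3) / 8 - 3 / 4 * b ^ 2 * c - 3 / 8 * b * c ^ 2) / 729
     = (a ^ 3 - 3 / 4 * (a * (b ^ 2 + b * c + c ^ 2)) + (c ^ 3 - b ^ 3) / 8 - 3 / 4 * (b ^ 2 * c) - 3 / 8 * (b * c ^ 2)) / 729"
    by (simp only: mult.assoc)
  also have "\<dots> = 56 + 32 * B + 80 / 3 * B ^ 2 + 40 * A + 32 * A * B + 56 / 3 * A * B ^ 2 + 32 * A ^ 2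
       + 24 * A ^ 2 * B + 16 * A ^ 2 * B ^ 2"
    unfolding a3 aK b3 c3 b2c bc2 by (simp add: field_simps)
  finally have E3: "(a ^ 3 - 3 / 4 * a * (b ^ 2 + b * c + c ^ 2) + (c ^ 3 - b ^ 3) / 8 - 3 / 4 * b ^ 2 * c - 3 / 8 * b * c ^ 2) / 729
     = 56 + 32 * B + 80 / 3 * B ^ 2 + 40 * A + 32 * A * B + 56 / 3 * A * B ^ 2 + 32 * A ^ 2
       + 24 * A ^ 2 * B + 16 * A ^ 2 * B ^ 2" .
  show "(a ^ 3 - 3 / 4 * a * (b ^ 2 + b * c + c ^ 2) + (c ^ 3 - b ^ 3) / 8 - 3 / 4 * b ^ 2 * c - 3 / 8 * b * c ^ 2) / 729
           * (1 - u + u ^ 2) = u ^ 7 * (4 + 2 * u + u ^ 2)"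
    unfolding E3 w u7 v by (simp add: r2)
  have s2: "(A + A ^ 2 + B) ^ 3 = 9 + 12 * B + 6 * A + 6 * A * B + 3 * A * B ^ 2 + 6 * A ^ 2
      + 3 * A ^ 2 * B + 3 * A ^ 2 * B ^ 2"
    by (simp add: power3_eq_cube r)
  have s3: "8 * (A + A ^ 2 + B) ^ 3 * (A - 1) =
      24 - 48 * B + 48 * B ^ 2 + 24 * A + 48 * A * B - 24 * A * B ^ 2 + 24 * A ^ 2 * B"
    unfolding s2 by (simp add: r)
  show "8 * (A + A ^ 2 + B) ^ 3 * (A - 1) * (1 - u + u ^ 2) = u ^ 7 * (4 + 2 * u + u ^ 2) * (9 - 2 * B ^ 4)"
    unfolding s3 w u7 v B4 by (simp add: r2)
qed

text \<open>The substitution C -> -F, F -> C - F permutes the roots of 8 t^3 - 6 t - 1 and, thanks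
  to d = b + c, cycles x, z, y. Hence the symmetric functions are free of C and F.\<close>

lemma cos_triple_symmetric:
  fixes C F a b c d :: real
  assumes C: "C ^ 3 = (6 * C + 1) / 8" and F: "F = 2 * C ^ 2 - 1" and d: "d = b + c"
    and x: "x = 1 / 9 * (a - b * C - c * F)"
    and y: "y = 1 / 9 * (a + d * C - b * F)"
    and z: "z = 1 / 9 * (a - c * C + d * F)"
  shows "x + y + z = a / 3"
    and "x * y + y * z + z * x = a ^ 2 / 27 - (b ^ 2 + b * c + c ^ 2) / 108"
    and "x * y * z = (a ^ 3 - 3 / 4 * a * (b ^ 2 + b * c + c ^ 2) + (c ^ 3 - b ^ 3) / 8
            - 3 / 4 * b ^ 2 * c - 3 / 8 * b * c ^ 2) / 729"
proof -
  \<comment> \<open>The facts \<open>cf\<close>, \<open>c2\<close>, \<open>f2\<close> are the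
    multiplication table for 1, C, F.\<close>
  have cf: "C * F = (2 * C + 1) / 4" using C unfolding F by (simp add: power3_eq_cube power2_eq_square field_simps)
  have c2: "C * C = (F + 1) / 2" unfolding F by (simp add: power2_eq_square)
  have f2: "F * F = (C - F + 1) / 2"
  proof -
    have "F * F = 2 * C * (C * F) - F" unfolding F by (simp add: power2_eq_square algebra_simps)
    also have "\<dots> = C * C + C / 2 - F" unfolding cf by (simp add: field_simps)
    finally show ?thesis unfolding c2 by (simp add: field_simps)
  qed
  have r: "C * (C * w) = (F + 1) / 2 * w" "C * (F * w) = (2 * C + 1) / 4 * w" "F * (F * w) = (C - F + 1) / 2 * w" for w
    by (simp_all only: mult.assoc[symmetric] cf c2 f2)
  show "x + y + z = a / 3" unfolding x y z d by (simp add: field_simps)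
  show "x * y + y * z + z * x = a ^ 2 / 27 - (b ^ 2 + b * c + c ^ 2) / 108"
    unfolding x y z d by (simp add: power2_eq_square field_simps cf c2 f2 r)
  show "x * y * z = (a ^ 3 - 3 / 4 * a * (b ^ 2 + b * c + c ^ 2) + (c ^ 3 - b ^ 3) / 8
            - 3 / 4 * b ^ 2 * c - 3 / 8 * b * c ^ 2) / 729"
    unfolding x y z d by (simp add: power2_eq_square power3_eq_cube field_simps cf c2 f2 r)
qed

text \<open>By Vieta both triples are the roots of one cubic, and the strict order decides which
  root is which.\<close>

lemma cubic_roots_unique:
  fixes a b c a' b' c' :: real
  assumes "a < b" "b < c" "a' < b'" "b' < c'"
    and e1: "a + b + c = a' + b' + c'" and e2: "a * b + b * c + c * a = a' * b' + b' * c' + c' * a'"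
    and e3: "a * b * c = a' * b' * c'"
  shows "a = a'" "b = b'" "c = c'"
proof -
  have "(t - a) * (t - b) * (t - c) = (t - a') * (t - b') * (t - c')" for t
  proof -
    have "(t - x) * (t - y) * (t - z) = t ^ 3 - (x + y + z) * t ^ 2 + (x * y + y * z + z * x) * t - x * y * z"
      for x y z :: real
      by (simp add: power3_eq_cube power2_eq_square algebra_simps)
    then show ?thesis by (simp only: e1 e2 e3)
  qed
  from this[of a] this[of b] this[of c]
  have "a \<in> {a', b', c'}" "b \<in> {a', b', c'}" "c \<in> {a', b', c'}" by auto
  with assms(1-4) show "a = a'" "b = b'" "c = c'" by auto
qed

subsection \<open>Symmetric functions and numerical bounds\<close>

text \<open>Division by \<open>phi q\<close> turns the homogeneous relations into relations in u
  alone. On the left stand the symmetric functions of \<open>u2 * u4\<^sup>2\<close>,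
  \<open>u4 * u1\<^sup>2\<close>, \<open>u1 * u2\<^sup>2\<close>, the third multiplied by 1 - u +
  u^2.\<close>

lemma rtheta_ninths_symmetric:
  assumes q: "0 < q" "q < 1"
  defines "u1 \<equiv> 2 * rtheta q (1/9) / phi q" and "u2 \<equiv> 2 * rtheta q (2/9) / phi q"
    and "u \<equiv> 2 * rtheta q (1/3) / phi q" and "u4 \<equiv> 2 * rtheta q (4/9) / phi q"
  shows "u1\<^sup>2 * u4 + u4\<^sup>2 * u2 + u2\<^sup>2 * u1 = u * (4 + 2 * u + u\<^sup>2)"
    and "u1 * u2 * u4 * (u2\<^sup>2 * u4 + u4\<^sup>2 * u1 + u1\<^sup>2 * u2) = 2 * u ^ 3 * (4 + 2 * u + u\<^sup>2)"
    and "(u1 * u2 * u4) ^ 3 * (1 - u + u\<^sup>2) = u ^ 7 * (4 + 2 * u + u\<^sup>2)"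
proof -
  define x0 where "x0 = phi q"
  define X where "X = phi (q ^ 3)"
  define Y where "Y = rtheta (q ^ 3) (1/3)"
  define v where "v = u * (4 + 2 * u + u\<^sup>2)"
  have q': "0 < q ^ 3" "q ^ 3 < 1" "0 < q ^ 9" "q ^ 9 < 1" using q by (auto simp: power_less_one_iff)
  have pos: "x0 > 0" "X > 0" "phi (q ^ 9) > 0" using phi_pos q q' by (auto simp: x0_def X_def)
  have x: "rtheta q (1/9) = u1 * x0 / 2" "rtheta q (2/9) = u2 * x0 / 2" "rtheta q (1/3) = u * x0 / 2"
    "rtheta q (4/9) = u4 * x0 / 2"
    using pos by (simp_all add: assms x0_def)
  note n = rtheta_ninths[OF q, folded x0_def X_def Y_def, unfolded x]
  note c = rtheta_cubic[OF q, folded x0_def X_def Y_def, unfolded x]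
  have RHS: "u * x0 / 2 * (x0\<^sup>2 + x0 * (u * x0 / 2) + (u * x0 / 2)\<^sup>2) = x0 ^ 3 / 8 * v"
    unfolding v_def by (simp add: power2_eq_square power3_eq_cube field_simps)
  have "x0 ^ 3 / 8 * (u1 * u2 * u4 * X) = x0 ^ 3 / 8 * (2 * u\<^sup>2 * Y)"
    using n(2) by (simp add: power2_eq_square power3_eq_cube field_simps)
  then have P: "u1 * u2 * u4 * X = 2 * u\<^sup>2 * Y"
    unfolding mult_cancel_left using pos by auto
  have "x0 ^ 3 / 8 * (u1\<^sup>2 * u4 + u4\<^sup>2 * u2 + u2\<^sup>2 * u1) = x0 ^ 3 / 8 * v"
    unfolding RHS[symmetric] n(3)[symmetric] by (simp add: power2_eq_square power3_eq_cube field_simps)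
  then show "u1\<^sup>2 * u4 + u4\<^sup>2 * u2 + u2\<^sup>2 * u1 = u * (4 + 2 * u + u\<^sup>2)"
    using pos unfolding v_def by simp
  define f where "f = u2\<^sup>2 * u4 + u4\<^sup>2 * u1 + u1\<^sup>2 * u2"
  have "x0 ^ 3 / 8 * (f * Y) = x0 ^ 3 / 8 * (v * X)"
    using n(4) unfolding RHS f_def by (simp add: power2_eq_square power3_eq_cube field_simps)
  then have F: "f * Y = v * X" using pos by simp
  have "u1 * u2 * u4 * f * X = 2 * u\<^sup>2 * (f * Y)" using P by (simp add: mult_ac)
  also have "\<dots> = 2 * u\<^sup>2 * v * X" by (simp add: F)
  finally have "u1 * u2 * u4 * f = 2 * u\<^sup>2 * v" using pos by simp
  then show "u1 * u2 * u4 * (u2\<^sup>2 * u4 + u4\<^sup>2 * u1 + u1\<^sup>2 * u2) = 2 * u ^ 3 * (4 + 2 * u + u\<^sup>2)"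
    unfolding f_def[symmetric] v_def by (simp add: power2_eq_square power3_eq_cube)
  have "3 * phi (q ^ 9) = x0 * (1 + u)" using c(3) by (simp add: field_simps)
  then have u_pos: "1 + u > 0" using pos by (metis mult_pos_pos zero_less_mult_pos zero_less_numeral)
  have c1: "72 * (X * Y ^ 3) = x0 ^ 4 * (v * (1 + u))"
    using c(1) unfolding RHS by (simp add: power4_eq_xxxx power3_eq_cube field_simps)
  have c2: "9 * X ^ 4 = x0 ^ 4 * ((1 + u) * (1 - u + u\<^sup>2))"
    unfolding c(2) by (simp add: power4_eq_xxxx power3_eq_cube power2_eq_square field_simps)
  \<comment> \<open>Multiplying the two cubic relations crosswise isolates the cube of Y / X; the
    common factor cancels because 1 + u > 0 by the trisection formula.\<close>
  have "(9 * x0 ^ 4 * X * (1 + u)) * (8 * Y ^ 3 * (1 - u + u\<^sup>2)) =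
      (72 * (X * Y ^ 3)) * (x0 ^ 4 * ((1 + u) * (1 - u + u\<^sup>2)))"
    by (simp add: mult_ac)
  also have "\<dots> = (x0 ^ 4 * (v * (1 + u))) * (9 * X ^ 4)" unfolding c1 c2 ..
  also have "\<dots> = (9 * x0 ^ 4 * X * (1 + u)) * (v * X ^ 3)" by (simp add: power4_eq_xxxx power3_eq_cube)
  finally have Y3: "8 * Y ^ 3 * (1 - u + u\<^sup>2) = v * X ^ 3" using pos u_pos by simp
  have "(u1 * u2 * u4) ^ 3 * (1 - u + u\<^sup>2) * X ^ 3 = (u1 * u2 * u4 * X) ^ 3 * (1 - u + u\<^sup>2)"
    by (simp add: power_mult_distrib)
  also have "\<dots> = u ^ 6 * (8 * Y ^ 3 * (1 - u + u\<^sup>2))" unfolding P by (simp add: power_mult_distrib)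
  also have "\<dots> = u ^ 7 * (4 + 2 * u + u\<^sup>2) * X ^ 3"
    unfolding Y3 v_def by (simp add: power_numeral_reduce)
  finally show "(u1 * u2 * u4) ^ 3 * (1 - u + u\<^sup>2) = u ^ 7 * (4 + 2 * u + u\<^sup>2)" using pos by simp
qed

lemma phi_upper_bound:
  fixes q :: real
  assumes q: "0 < q" "q \<le> 1 / 4"
  shows "phi q \<le> 1 + 2 * q + q / 16"
proof -
  define a where "a j = q ^ (j\<^sup>2) + q ^ ((Suc j)\<^sup>2)" for j
  have "a = (\<lambda>j. q powi (int j)\<^sup>2 + q powi (- 1 - int j)\<^sup>2)"
  proof
    fix j
    have "(- 1 - int j)\<^sup>2 = int ((Suc j)\<^sup>2)" "(int j)\<^sup>2 = int (j\<^sup>2)" by (simp_all add: power2_eq_square algebra_simps)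
    then show "a j = q powi (int j)\<^sup>2 + q powi (- 1 - int j)\<^sup>2" by (simp only: a_def power_int_of_nat)
  qed
  then have "a sums phi q" using has_sum_int_imp_sums[OF phi_has_sum[of q]] q by simp
  then have "(\<lambda>j. a (j + 2)) sums (phi q - (\<Sum>j<2. a j))" by (rule sums_split_initial_segment)
  \<comment> \<open>The first two pairs cover the indices 0, -1, 1, -2, so one term q^4 is split off
    here and the one for index 2 stays in the tail.\<close>
  moreover have "(\<Sum>j<2. a j) = 1 + 2 * q + q ^ 4"
    by (simp add: a_def lessThan_Suc numeral_2_eq_2 power4_eq_xxxx)
  ultimately have s: "(\<lambda>j. a (j + 2)) sums (phi q - (1 + 2 * q + q ^ 4))" by simp
  have g: "(\<lambda>j. (2 * q ^ 4) * q ^ j) sums ((2 * q ^ 4) * (1 / (1 - q)))"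
    using q by (intro sums_mult geometric_sums) auto
  have "a (j + 2) \<le> (2 * q ^ 4) * q ^ j" for j
  proof -
    have "4 + j \<le> (j + 2)\<^sup>2" "4 + j \<le> (Suc (j + 2))\<^sup>2" by (simp_all add: power2_eq_square)
    then have "q ^ ((j + 2)\<^sup>2) \<le> q ^ (4 + j)" "q ^ ((Suc (j + 2))\<^sup>2) \<le> q ^ (4 + j)"
      using q by (simp_all only: power_decreasing)
    then show ?thesis unfolding a_def by (simp add: power_add)
  qed
  from sums_le[OF this s g] have "phi q \<le> 1 + 2 * q + q ^ 4 * (1 + 2 / (1 - q))"
    by (simp add: algebra_simps)
  \<comment> \<open>With q at most 1/4 the excess is at most q (1/64) (11/3) = 11 q / 192, just
    below q / 16 = 12 q / 192.\<close>
  also have "1 + 2 / (1 - q) \<le> 11 / 3" using q by (simp add: field_simps)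
  then have "q ^ 4 * (1 + 2 / (1 - q)) \<le> q ^ 4 * (11 / 3)" using q by (intro mult_left_mono) auto
  also have "q ^ 4 = q * q ^ 3" by (simp add: power_numeral_reduce)
  also have "q ^ 3 \<le> (1 / 4) ^ 3" using q by (intro power_mono) auto
  then have "q * q ^ 3 * (11 / 3) \<le> q * (1 / 4) ^ 3 * (11 / 3)" using q by (intro mult_right_mono mult_left_mono) auto
  finally show ?thesis using q by (simp add: power3_eq_cube)
qed

text \<open>For |s| at most 1 the series of phi + s rtheta has nonnegative terms, hence exceeds its
  part over -1, 0, 1. Taking s = 1 and s = -1 together with the upper bound for \<open>phi\<close>
  encloses \<open>rtheta\<close> from both sides.\<close>

lemma rtheta_bounds:
  assumes q: "0 < q" "q \<le> 1 / 4"
  shows "\<bar>rtheta q x - (1 + 2 * q * cos (2 * pi * x))\<bar> \<le> q / 16"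
proof -
  define f where "f n = q powi n\<^sup>2" for n :: int
  define C where "C n = cos (2 * pi * x * of_int n)" for n :: int
  have f0: "f n \<ge> 0" for n using q by (simp add: f_def)
  have phi: "(f has_sum phi q) UNIV" unfolding f_def[abs_def] using q by (intro phi_has_sum) auto
  have "((\<lambda>n. Re (of_real (f n) * cis (2 * pi * x) powi n)) has_sum rtheta q x) UNIV"
    unfolding rtheta_def f_def using q by (intro has_sum_Re theta_has_sum) auto
  moreover have "(\<lambda>n. Re (of_real (f n) * cis (2 * pi * x) powi n)) = (\<lambda>n. f n * C n)"
    by (auto simp: cis_power_int C_def mult_ac)
  ultimately have th: "((\<lambda>n. f n * C n) has_sum rtheta q x) UNIV" by simp
  have le: "2 * q * (1 + s * cos (2 * pi * x)) + (1 + s) \<le> phi q + s * rtheta q x" if s: "\<bar>s\<bar> \<le> 1" for s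
  proof -
    have 1: "((\<lambda>n. f n + s * (f n * C n)) has_sum (phi q + s * rtheta q x)) UNIV"
      by (intro has_sum_add has_sum_cmult_right phi th)
    have 2: "((\<lambda>n. f n + s * (f n * C n)) has_sum (\<Sum>n\<in>{- 1, 0, 1}. f n + s * (f n * C n))) {- 1, 0, 1}"
      by (intro has_sum_finite) auto
    have 3: "0 \<le> f n + s * (f n * C n)" for n
    proof -
      have "\<bar>s * C n\<bar> \<le> 1 * 1" unfolding abs_mult C_def using s by (intro mult_mono) auto
      then have "0 \<le> 1 + s * C n" by linarith
      then have "0 \<le> f n * (1 + s * C n)" using f0 by (intro mult_nonneg_nonneg)
      then show ?thesis by (simp add: algebra_simps)
    qed
    have "(\<Sum>n\<in>{- 1, 0, 1}. f n + s * (f n * C n)) \<le> phi q + s * rtheta q x"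
      by (rule has_sum_mono_neutral[OF 2 1]) (use 3 in auto)
    moreover have "(\<Sum>n\<in>{- 1, 0, 1}. f n + s * (f n * C n)) = 2 * q * (1 + s * cos (2 * pi * x)) + (1 + s)"
      by (simp add: f_def C_def algebra_simps)
    ultimately show ?thesis by simp
  qed
  define y where "y = 2 * q * cos (2 * pi * x)"
  have "2 * q + y + 2 \<le> phi q + rtheta q x" using le[of 1] by (simp add: y_def algebra_simps)
  moreover have "2 * q - y \<le> phi q - rtheta q x" using le[of "- 1"] by (simp add: y_def algebra_simps)
  moreover have "phi q \<le> 1 + 2 * q + q / 16" using q by (rule phi_upper_bound)
  ultimately show ?thesis unfolding y_def[symmetric] by linarith
qed

lemma cos_pi_ninths:
  defines "C \<equiv> cos (pi / 9)"
  shows "C ^ 3 = (6 * C + 1) / 8" and "cos (2 * pi / 9) = 2 * C\<^sup>2 - 1"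
    and "cos (4 * pi / 9) = C - cos (2 * pi / 9)" and "cos (8 * pi / 9) = - C"
    and "93 / 100 < C" and "C < 95 / 100"
proof -
  have "1 / 2 = cos (3 * (pi / 9))" by (simp add: cos_60)
  also have "\<dots> = 4 * C ^ 3 - 3 * C" unfolding C_def by (rule cos_treble_cos)
  finally show C3: "C ^ 3 = (6 * C + 1) / 8" by simp
  show c2: "cos (2 * pi / 9) = 2 * C\<^sup>2 - 1"
    using cos_double_cos[of "pi / 9"] by (simp add: C_def)
  have "cos (4 * pi / 9) = 2 * (2 * C\<^sup>2 - 1)\<^sup>2 - 1"
    using cos_double_cos[of "2 * pi / 9"] by (simp add: c2)
  also have "\<dots> = 8 * C * C ^ 3 - 8 * C\<^sup>2 + 1" by (simp add: power2_eq_square power3_eq_cube algebra_simps)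
  also have "\<dots> = C - (2 * C\<^sup>2 - 1)" unfolding C3 by (simp add: power2_eq_square field_simps)
  finally show "cos (4 * pi / 9) = C - cos (2 * pi / 9)" unfolding c2 .
  have "8 * pi / 9 = pi - pi / 9" by simp
  then show "cos (8 * pi / 9) = - C" by (simp only: cos_pi_minus C_def)
  have "cos (pi / 3) < C" unfolding C_def by (intro cos_monotone_0_pi) auto
  then have half: "C > 1 / 2" by (simp add: cos_60)
  \<comment> \<open>C solves 8 t^3 - 6 t = 1 and exceeds 1/2, beyond which the left side is
    increasing; evaluating it at two rationals brackets C.\<close>
  have mono: "8 * y ^ 3 - 6 * y \<le> 8 * z ^ 3 - 6 * z" if "1 / 2 \<le> y" "y \<le> z" for y z :: real
  proof -
    have "1 / 4 \<le> y * y" "1 / 4 \<le> y * z" "1 / 4 \<le> z * z"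
      using that mult_mono[of "1/2" y "1/2" y] mult_mono[of "1/2" y "1/2" z] mult_mono[of "1/2" z "1/2" z] by auto
    then have "0 \<le> (z - y) * (8 * (y * y + y * z + z * z) - 6)" using that by (intro mult_nonneg_nonneg) auto
    then show ?thesis by (simp add: power3_eq_cube algebra_simps)
  qed
  have C1: "8 * C ^ 3 - 6 * C = 1" unfolding C3 by (simp add: field_simps)
  show "93 / 100 < C"
  proof (rule ccontr)
    assume "\<not> 93 / 100 < C"
    then show False using mono[of C "93 / 100"] half C1 by (simp add: power3_eq_cube)
  qed
  show "C < 95 / 100"
  proof (rule ccontr)
    assume "\<not> C < 95 / 100"
    then show False using mono[of "95 / 100" C] C1 by (simp add: power3_eq_cube)
  qed
qed

text \<open>Up to q / 16 the values are 1 + 2 q times a cosine, so bounds on cos (pi/9) decide the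
  order. The last inequality serves to place \<open>v1 * v2\<^sup>2\<close> above
  \<open>v4 * v1\<^sup>2\<close> in the final comparison.\<close>

lemma rtheta_ninths_order:
  assumes q: "0 < q" "q \<le> 1 / 4"
  defines "x1 \<equiv> rtheta q (1/9)" and "x2 \<equiv> rtheta q (2/9)" and "x4 \<equiv> rtheta q (4/9)"
  shows "0 < x4" "x4 < x2" "x2 < x1" "x4 * x1 < x2\<^sup>2"
proof -
  define C where "C = cos (pi / 9)"
  define c where "c = 2 * C\<^sup>2 - 1"
  note C = cos_pi_ninths[folded C_def]
  have "(93 / 100)\<^sup>2 < C\<^sup>2" using C(5) by (intro power_strict_mono) auto
  moreover have "C\<^sup>2 < (95 / 100)\<^sup>2" using C(5,6) by (intro power_strict_mono) auto
  ultimately have c: "72 / 100 < c" "c < 81 / 100" unfolding c_def by (simp_all add: power2_eq_square)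
  have x1: "\<bar>x1 - (1 + 2 * q * c)\<bar> \<le> q / 16"
    using rtheta_bounds[OF q, of "1/9"] C(2) unfolding x1_def c_def by simp
  have x2: "\<bar>x2 - (1 + 2 * q * (C - c))\<bar> \<le> q / 16"
    using rtheta_bounds[OF q, of "2/9"] C(2,3) unfolding x2_def c_def by simp
  have x4: "\<bar>x4 - (1 - 2 * q * C)\<bar> \<le> q / 16"
    using rtheta_bounds[OF q, of "4/9"] C(4) unfolding x4_def by simp
  have qc: "72 / 100 * q < q * c" "q * c < 81 / 100 * q" "93 / 100 * q < q * C" "q * C < 95 / 100 * q"
    using c C(5,6) q by simp_all
  have b: "x1 \<le> 1 + 2 * (q * c) + q / 16" "1 + 2 * (q * c) - q / 16 \<le> x1"
    "x2 \<le> 1 + 2 * (q * C) - 2 * (q * c) + q / 16" "1 + 2 * (q * C) - 2 * (q * c) - q / 16 \<le> x2"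
    "x4 \<le> 1 - 2 * (q * C) + q / 16" "1 - 2 * (q * C) - q / 16 \<le> x4"
    using x1 x2 x4 unfolding right_diff_distrib mult.assoc by linarith+
  show "0 < x4" "x4 < x2" "x2 < x1" using b qc q by linarith+
  define a where "a = x1 - 1" define e where "e = x4 - 1" define g where "g = x2 - 1"
  have "a > 0" "e < 0" using b qc q unfolding a_def e_def by linarith+
  moreover have "a + e < 2 * g"
  proof -
    define s t where "s = q * c" and "t = q * C"
    \<comment> \<open>The main terms of 2 g - (a + e) are 6 t - 6 s, and four error terms q / 16 add
      up to q / 4.\<close>
    have "q / 4 < 6 * t - 6 * s" using qc q unfolding s_def t_def by linarith
    moreover have "x1 \<le> 1 + 2 * s + q / 16" "1 + 2 * t - 2 * s - q / 16 \<le> x2" "x4 \<le> 1 - 2 * t + q / 16"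
      using b unfolding s_def t_def by auto
    ultimately show ?thesis unfolding a_def e_def g_def by argo
  qed
  ultimately have a: "a > 0" "a + e < 2 * g" "e < 0" by blast+
  then have "e * a < 0" by (simp add: mult_neg_pos)
  have "x4 * x1 = 1 + (a + e) + e * a" by (simp add: a_def e_def algebra_simps)
  also have "\<dots> < 1 + 2 * g + g\<^sup>2" using a \<open>e * a < 0\<close> zero_le_power2[of g] by linarith
  also have "\<dots> = x2\<^sup>2" by (simp add: g_def power2_eq_square algebra_simps)
  finally show "x4 * x1 < x2\<^sup>2" .
qed

subsection \<open>The evaluation\<close>

lemma root_3_cube: "root 3 (x ^ 3) = x"
  by (simp add: odd_real_root_power_cancel)

text \<open>With \<open>q0 = exp (- pi / sqrt 3)\<close> one has \<open>q0 ^ 3 = exp (- pi * sqrt 3)\<close>, and the inversion formula at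
  \<open>t = sqrt 3\<close> links \<open>phi q0\<close> with \<open>phi (q0 ^ 3)\<close>: this fixes the modulus on which the cubic relation acts.\<close>
lemma rtheta_third_cube:
  defines "q \<equiv> exp (- pi * sqrt 3)"
  shows "(2 * rtheta q (1/3) / phi q) ^ 3 = 2 * (1 + root 3 2 + (root 3 2)\<^sup>2)"
proof -
  define q0 where "q0 = exp (- pi / sqrt 3)"
  define A where "A = root 3 (2 :: real)"
  define x where "x = rtheta q0 (1/3)"
  define y where "y = rtheta q (1/3)"
  have A3: "A ^ 3 = 2" by (simp add: A_def)
  have "3 * (- pi / sqrt 3) = - pi * sqrt 3" by (simp add: field_simps)
  then have q03: "q0 ^ 3 = q" unfolding q0_def q_def by (simp flip: exp_of_nat_mult)
  have q0: "0 < q0" "q0 < 1" by (simp_all add: q0_def)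
  have q: "0 < q" "q < 1" by (simp_all add: q_def)
  have q9: "q0 ^ 9 = q ^ 3" unfolding q03[symmetric] by simp
  note c0 = rtheta_cubic(2,3)[OF q0, folded x_def, unfolded q03 q9] and c = rtheta_cubic(2)[OF q, folded y_def]
  have pos: "phi q0 > 0" "phi q > 0" using phi_pos q0 q by auto
  have "phi q0 = sqrt (sqrt 3) * phi q" unfolding q0_def q_def by (rule phi_inversion) simp
  then have "phi q0 ^ 4 = (sqrt (sqrt 3) ^ 2) ^ 2 * phi q ^ 4" by (simp only: power_mult_distrib flip: power_mult) simp
  then have k: "phi q0 ^ 4 = 3 * phi q ^ 4" by simp
  \<comment> \<open>Since phi (q0^3) = phi q, inversion expresses the left side of the cubic
    relation at q0 by phi q0 as well, leaving a pure cubic equation for 2 x / phi q0.\<close>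
  have "phi q0 * (phi q0 ^ 3 + 8 * x ^ 3) = 3 * phi q0 ^ 4" using c0(1) k by simp
  then have "phi q0 * ((2 * x) ^ 3) = phi q0 * (2 * phi q0 ^ 3)"
    by (simp add: power_mult_distrib algebra_simps power_numeral_reduce)
  then have "(2 * x / phi q0) ^ 3 = 2" using pos by (simp add: power_divide field_simps)
  then have "2 * x / phi q0 = A" unfolding A_def by (metis root_3_cube)
  then have "2 * x = A * phi q0" using pos by (simp add: field_simps)
  \<comment> \<open>Trisection at q0 reaches phi (q0^9) = phi (q^3), the quantity in the cubic
    relation at q.\<close>
  then have "3 * phi (q ^ 3) = (1 + A) * phi q0" using c0(2) by (simp add: algebra_simps)
  then have "(3 * phi (q ^ 3)) ^ 4 = (1 + A) ^ 4 * (3 * phi q ^ 4)" by (simp only: power_mult_distrib k)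
  then have 1: "27 * phi (q ^ 3) ^ 4 = (1 + A) ^ 4 * phi q ^ 4" by (simp add: power_mult_distrib)
  have "9 * phi (q ^ 3) ^ 4 = (1 + (2 * y / phi q) ^ 3) * phi q ^ 4"
    unfolding c using pos by (simp add: field_simps power_numeral_reduce)
  with 1 have "(3 * (1 + (2 * y / phi q) ^ 3)) * phi q ^ 4 = (1 + A) ^ 4 * phi q ^ 4" by linarith
  then have "1 + (2 * y / phi q) ^ 3 = (1 + A) ^ 4 / 3" using pos by simp
  moreover have "(1 + A) ^ 4 / 3 = 1 + 2 * (1 + A + A\<^sup>2)"
  proof -
    have "(1 + A) ^ 4 = 1 + 4 * A + 6 * A\<^sup>2 + 4 * A ^ 3 + A * A ^ 3"
      by (simp add: power_numeral_reduce algebra_simps)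
    then show ?thesis unfolding A3 by simp
  qed
  ultimately show ?thesis unfolding y_def A_def by simp
qed

section \<open>Numerical bounds for the nome, the cube roots and the coefficients\<close>

lemma exp_minus_pi_sqrt_3_le: "exp (- pi * sqrt 3) \<le> (1 / 4 :: real)"
proof -
  have "1 \<le> sqrt 3" by simp
  then have "3 * 1 \<le> pi * sqrt 3" using pi_gt3 by (intro mult_mono) auto
  then have "4 \<le> exp (pi * sqrt 3)" using exp_ge_add_one_self[of "pi * sqrt 3"] by linarith
  then have "inverse (exp (pi * sqrt 3)) \<le> inverse 4" by (intro le_imp_inverse_le) auto
  then show ?thesis by (simp add: exp_minus)
qed

lemma root_3_bounds:
  "12599 / 10000 < root 3 (2 :: real)" "root 3 (2 :: real) < 126 / 100"
  "14422 / 10000 < root 3 (3 :: real)" "root 3 (3 :: real) < 14423 / 10000"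
proof -
  have "root 3 ((12599 / 10000) ^ 3) < root 3 2" "root 3 2 < root 3 ((126 / 100) ^ 3)"
    "root 3 ((14422 / 10000) ^ 3) < root 3 3" "root 3 3 < root 3 ((14423 / 10000) ^ 3)"
    by (simp_all add: power3_eq_cube)
  then show "12599 / 10000 < root 3 (2 :: real)" "root 3 (2 :: real) < 126 / 100"
    "14422 / 10000 < root 3 (3 :: real)" "root 3 (3 :: real) < 14423 / 10000"
    by (simp_all only: root_3_cube)
qed

text \<open>Both coefficients are small differences of larger monomials, hence the four-digit bounds
  on the cube roots. The result serves to order \<alpha>, \<beta>, \<gamma>.\<close>

lemma coefficient_bounds:
  fixes A B b c :: real
  assumes A: "12599 / 10000 < A" "A < 126 / 100" and B: "14422 / 10000 < B" "B < 14423 / 10000"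
    and b: "b = 4 * (1 + B * (B + 1) - 2 * A * (B + A - 1))"
    and c: "c = 4 * (1 - A * (B - 1) * (B + A - 1))"
  shows "92 / 100 < b" "b < 94 / 100" "20 / 100 < c" "c < 22 / 100"
proof -
  have m: "l * l' < x * y \<and> x * y < r * r'" if "0 < l" "0 < l'" "l < x" "x < r" "l' < y" "y < r'"
    for l l' x y r r' :: real
    using that mult_strict_mono[of l x l' y] mult_strict_mono[of x r y r'] by auto
  have AA: "15873 / 10000 < A * A" "A * A < 15876 / 10000" using m[OF _ _ A A] by auto
  have BB: "20799 / 10000 < B * B" "B * B < 20803 / 10000" using m[OF _ _ B B] by auto
  have AB: "18170 / 10000 < A * B" "A * B < 18174 / 10000" using m[OF _ _ A B] by auto
  have ABB: "26204 / 10000 < A * (B * B)" "A * (B * B) < 26212 / 10000" using m[OF _ _ A BB] by auto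
  have AAB: "22891 / 10000 < A * A * B" "A * A * B < 22899 / 10000" using m[OF _ _ AA B] by auto
  have b': "b = 4 + 4 * B + 4 * (B * B) + 8 * A - 8 * (A * B) - 8 * (A * A)" unfolding b by (simp add: algebra_simps)
  have c': "c = 4 - 4 * A + 8 * (A * B) - 4 * (A * (B * B)) + 4 * (A * A) - 4 * (A * A * B)"
    unfolding c by (simp add: algebra_simps)
  show "92 / 100 < b" "b < 94 / 100" unfolding b' using A B AA AB BB by linarith+
  show "20 / 100 < c" "c < 22 / 100" unfolding c' using A B AA AB ABB AAB by linarith+
qed

theorem theorem4p13:
  fixes p a b c d \<alpha> \<beta> \<gamma> u1 u2 u3 u4 :: real
  assumes p: "p = 2 * (root 3 2 + (root 3 2) ^ 2 + root 3 3) * root 3 (root 3 2 - 1)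
                    / root 3 (9 - 2 * (root 3 3) ^ 4)"
    and a: "a = 4 * root 3 2 * (root 3 3) ^ 2 * (1 + root 3 2)
                + 2 * root 3 3 * (root 3 2 + (root 3 2) ^ 2) ^ 2
                + 6 * (1 + root 3 2 + (root 3 2) ^ 2)"
    and b: "b = 4 * (1 + root 3 3 * (root 3 3 + 1) - 2 * root 3 2 * (root 3 3 + root 3 2 - 1))"
    and c: "c = 4 * (1 - root 3 2 * (root 3 3 - 1) * (root 3 3 + root 3 2 - 1))"
    and d: "d = 4 * ((2 - root 3 2) * (1 + root 3 2)
                     - root 3 3 * (root 3 2 - 1) * (1 + root 3 2 + root 3 3))"
    and \<alpha>: "\<alpha> = 1 / 9 * (a - b * cos (pi / 9) - c * cos (2 * pi / 9))"
    and \<beta>: "\<beta> = 1 / 9 * (a + d * cos (pi / 9) - b * cos (2 * pi / 9))"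
    and \<gamma>: "\<gamma> = 1 / 9 * (a - c * cos (pi / 9) + d * cos (2 * pi / 9))"
    and u1: "u1 = root 3 (\<beta> * p / \<alpha>)"
    and u2: "u2 = root 3 (\<gamma> * p / \<beta>)"
    and u3: "u3 = root 3 (2 * (1 + root 3 2 + (root 3 2) ^ 2))"
    and u4: "u4 = root 3 (\<alpha> * p / \<gamma>)"
  shows "phi (exp (- 81 * pi * sqrt 3)) / phi (exp (- pi * sqrt 3))
         = 1 / 9 * (1 + u1 + u2 + u3 + u4)"
proof -
  define A where "A = root 3 (2 :: real)"
  define B where "B = root 3 (3 :: real)"
  define C where "C = cos (pi / 9)"
  define F where "F = cos (2 * pi / 9)"
  define q where "q = exp (- pi * sqrt 3)"
  define v1 where "v1 = 2 * rtheta q (1/9) / phi q"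
  define v2 where "v2 = 2 * rtheta q (2/9) / phi q"
  define u where "u = 2 * rtheta q (1/3) / phi q"
  define v4 where "v4 = 2 * rtheta q (4/9) / phi q"
  have A3: "A ^ 3 = 2" and B3: "B ^ 3 = 3" by (simp_all add: A_def B_def)
  have q4: "0 < q" "q \<le> 1 / 4" unfolding q_def using exp_minus_pi_sqrt_3_le by auto
  then have q: "0 < q" "q < 1" by auto
  have x0: "phi q > 0" using phi_pos q by blast
  have cube_inj: "x = y" if "x ^ 3 = y ^ 3" for x y :: real using that root_3_cube by metis

  note a' = a[folded A_def B_def] and b' = b[folded A_def B_def] and c' = c[folded A_def B_def]
  note id = cubic_field_identities[OF A3 B3 a' b' c' refl]
  have "u ^ 3 = 2 * (1 + A + A\<^sup>2)" unfolding u_def q_def A_def by (rule rtheta_third_cube)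
  \<comment> \<open>Real cubing is injective, so the value of u^3 determines the denested form of
    u.\<close>
  then have u: "u = (A + A ^ 2) * B ^ 2 / 3" using id(1) cube_inj by metis
  have u3': "u3 = u" unfolding u3 A_def[symmetric] u id(1)[symmetric] by (rule root_3_cube)
  note id = cubic_field_identities[OF A3 B3 a' b' c' u]
  have w_pos: "1 - u + u\<^sup>2 > 0"
  proof -
    have "1 - u + u\<^sup>2 = (u - 1 / 2)\<^sup>2 + 3 / 4" by (simp add: power2_eq_square algebra_simps)
    then show ?thesis by (simp add: add_nonneg_pos)
  qed

  note sym = rtheta_ninths_symmetric[OF q, folded v1_def v2_def u_def v4_def]
  have v: "0 < v4" "v4 < v2" "v2 < v1" "v4 * v1 < v2\<^sup>2"
  proof -
    note o = rtheta_ninths_order[OF q4]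
    show "0 < v4" "v4 < v2" "v2 < v1"
      using o(1-3) x0 unfolding v1_def v2_def v4_def by (simp_all add: divide_strict_right_mono)
    have "v4 * v1 = 4 / (phi q)\<^sup>2 * (rtheta q (4/9) * rtheta q (1/9))"
      by (simp add: v1_def v4_def power2_eq_square)
    also have "\<dots> < 4 / (phi q)\<^sup>2 * (rtheta q (2/9))\<^sup>2" using o(4) x0 by (intro mult_strict_left_mono) auto
    also have "\<dots> = v2\<^sup>2" by (simp add: v2_def power2_eq_square)
    finally show "v4 * v1 < v2\<^sup>2" .
  qed
  have vpos: "v1 > 0" "v2 > 0" "v4 > 0" using v by auto

  have d': "d = b + c" unfolding b c d by (simp add: power2_eq_square algebra_simps)
  have C3: "C ^ 3 = (6 * C + 1) / 8" and F: "F = 2 * C ^ 2 - 1" and Cb: "93 / 100 < C" "C < 95 / 100"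
    using cos_pi_ninths unfolding C_def F_def by auto
  note cs = cos_triple_symmetric[OF C3 F d' \<alpha>[folded C_def F_def] \<beta>[folded C_def F_def] \<gamma>[folded C_def F_def]]

  \<comment> \<open>With d = b + c the differences are linear in C and F, with coefficients whose
    bounds settle the sign.\<close>
  have order: "\<alpha> < \<beta>" "\<beta> < \<gamma>"
  proof -
    note bc = coefficient_bounds[OF root_3_bounds b c]
    have "(93 / 100)\<^sup>2 < C\<^sup>2" "C\<^sup>2 < (95 / 100)\<^sup>2"
      using Cb by (auto intro!: power_strict_mono)
    then have Fb: "72 / 100 < F" "F < 81 / 100" unfolding F by (simp_all add: power2_eq_square)
    have "(b - c) * F < 74 / 100 * (81 / 100)" using bc Fb by (intro mult_strict_mono) auto
    moreover have "2 * (93 / 100) < (2 * b + c) * C" using bc Cb by (intro mult_strict_mono) auto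
    moreover have "\<beta> - \<alpha> = 1 / 9 * ((2 * b + c) * C - (b - c) * F)"
      unfolding \<alpha> \<beta> d' C_def F_def by (simp add: algebra_simps)
    ultimately show "\<alpha> < \<beta>" by argo
    have "(b + 2 * c) * C < 138 / 100 * (95 / 100)" using bc Cb by (intro mult_strict_mono) auto
    moreover have "204 / 100 * (72 / 100) < (2 * b + c) * F" using bc Fb by (intro mult_strict_mono) auto
    moreover have "\<gamma> - \<beta> = 1 / 9 * ((2 * b + c) * F - (b + 2 * c) * C)"
      unfolding \<gamma> \<beta> d' C_def F_def by (simp add: algebra_simps)
    ultimately show "\<beta> < \<gamma>" by argo
  qed

  have P3: "\<alpha> * \<beta> * \<gamma> = (v1 * v2 * v4) ^ 3"
  proof -
    have "\<alpha> * \<beta> * \<gamma> * (1 - u + u\<^sup>2) = (v1 * v2 * v4) ^ 3 * (1 - u + u\<^sup>2)"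
      unfolding cs(3) sym(3) id(4) ..
    then show ?thesis using w_pos by simp
  qed
  \<comment> \<open>The matching is forced by the target: with p = v1 v2 v4 these values give
    \<beta> p / \<alpha> = v1^3, and likewise for the other two.\<close>
  have "\<alpha> = v2 * v4\<^sup>2 \<and> \<beta> = v4 * v1\<^sup>2 \<and> \<gamma> = v1 * v2\<^sup>2"
  proof -
    have 1: "v2 * v4\<^sup>2 < v4 * v1\<^sup>2"
    proof -
      have "v2 * v4 < v1 * v1" using v vpos by (intro mult_strict_mono) auto
      then have "v4 * (v2 * v4) < v4 * (v1 * v1)" using vpos by simp
      then show ?thesis by (simp add: power2_eq_square mult_ac)
    qed
    have "v1 * (v4 * v1) < v1 * v2\<^sup>2" using v vpos by simp
    then have 2: "v4 * v1\<^sup>2 < v1 * v2\<^sup>2" by (simp add: power2_eq_square mult_ac)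
    have e1: "\<alpha> + \<beta> + \<gamma> = v2 * v4\<^sup>2 + v4 * v1\<^sup>2 + v1 * v2\<^sup>2"
    proof -
      have "a / 3 = v1\<^sup>2 * v4 + v4\<^sup>2 * v2 + v2\<^sup>2 * v1" unfolding id(2) sym(1) by simp
      then show ?thesis unfolding cs(1) by (simp add: mult_ac)
    qed
    have "\<alpha> * \<beta> + \<beta> * \<gamma> + \<gamma> * \<alpha> = v1 * v2 * v4 * (v2\<^sup>2 * v4 + v4\<^sup>2 * v1 + v1\<^sup>2 * v2)"
      unfolding cs(2) id(3) sym(2) ..
    then have e2: "\<alpha> * \<beta> + \<beta> * \<gamma> + \<gamma> * \<alpha> = (v2 * v4\<^sup>2) * (v4 * v1\<^sup>2) + (v4 * v1\<^sup>2) * (v1 * v2\<^sup>2) + (v1 * v2\<^sup>2) * (v2 * v4\<^sup>2)"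
      by (simp add: power2_eq_square algebra_simps)
    have e3: "\<alpha> * \<beta> * \<gamma> = (v2 * v4\<^sup>2) * (v4 * v1\<^sup>2) * (v1 * v2\<^sup>2)"
      unfolding P3 by (simp add: power2_eq_square power3_eq_cube mult_ac)
    show ?thesis using cubic_roots_unique[OF order 1 2 e1 e2 e3] by blast
  qed
  then have abc: "\<alpha> = v2 * v4\<^sup>2" "\<beta> = v4 * v1\<^sup>2" "\<gamma> = v1 * v2\<^sup>2" by auto

  have pP: "p = v1 * v2 * v4"
  proof (rule cube_inj)
    \<comment> \<open>B^4 = 3 B is below 4.5, so the radicand in the denominator of p is positive
      and can be cancelled.\<close>
    have "B * B ^ 3 < 15 / 10 * 3" unfolding B3 using root_3_bounds(4) by (simp add: B_def)
    then have nz: "9 - 2 * B ^ 4 > 0" by (simp add: power_numeral_reduce)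
    have "p ^ 3 = 8 * (A + A ^ 2 + B) ^ 3 * (A - 1) / (9 - 2 * B ^ 4)"
      unfolding p A_def[symmetric] B_def[symmetric] power_divide power_mult_distrib[of _ "root 3 _"]
      unfolding power_mult_distrib[of 2] by (simp add: odd_real_root_pow)
    then have "p ^ 3 * (1 - u + u\<^sup>2) = u ^ 7 * (4 + 2 * u + u\<^sup>2) * (9 - 2 * B ^ 4) / (9 - 2 * B ^ 4)"
      unfolding id(5)[symmetric] by simp
    then have "p ^ 3 * (1 - u + u\<^sup>2) = u ^ 7 * (4 + 2 * u + u\<^sup>2)" using nz by simp
    then have "p ^ 3 * (1 - u + u\<^sup>2) = (v1 * v2 * v4) ^ 3 * (1 - u + u\<^sup>2)" unfolding sym(3) .
    then show "p ^ 3 = (v1 * v2 * v4) ^ 3" using w_pos by simp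
  qed
  have "\<beta> * p / \<alpha> = v1 ^ 3" "\<gamma> * p / \<beta> = v2 ^ 3" "\<alpha> * p / \<gamma> = v4 ^ 3"
    unfolding abc pP using vpos by (simp_all add: power2_eq_square power3_eq_cube field_simps)
  then have u': "u1 = v1" "u2 = v2" "u4 = v4" unfolding u1 u2 u4 by (simp_all only: root_3_cube)

  have "q ^ 81 = exp (- 81 * pi * sqrt 3)" unfolding q_def by (simp flip: exp_of_nat_mult)
  then have "9 * phi (exp (- 81 * pi * sqrt 3)) =
      phi q + 2 * (rtheta q (1/9) + rtheta q (2/9) + rtheta q (1/3) + rtheta q (4/9))"
    using rtheta_ninths(1)[OF q] by simp
  then show ?thesis
    unfolding u' u3' v1_def v2_def u_def v4_def q_def[symmetric] using x0 by (simp add: field_simps)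
qed

end
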